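(* Let $f(z) = e^{2\pi i \alpha} z + O(z^2)$, $\alpha \in \mathbb{R}\setminus\mathbb{Q}$, be a nonlinearizable germ of holomorphic diffeomorphism fixing $0$, and let $K$ be a hedgehog of $f$. Let $T(z) = z + O(z^2)$ be a holomorphic germ tangent to the identity which is univalent on a neighbourhood of $K$, and suppose $K$ is either forward invariant under $T$ (i.e. $T(K)\subseteq K$) or backward invariant under $T$ (i.e. $K \subseteq T(K)$, equivalently $T^{-1}(K)\subseteq K$ for the inverse of $T$ on its image). Then $T$ is the identity.
   Context: A germ $f(z)=e^{2\pi i\alpha}z+O(z^2)$ with $\alpha\in\mathbb{R}\setminus\mathbb{Q}$ is linearizable if there is a holomorphic change of variables $h(w)=w+O(w^2)$ with $h^{-1}\circ f\circ h=R_\alpha$, where $R_\alpha(w)=e^{2\pi i\alpha}w$; otherwise it is nonlinearizable. A Siegel compact of $f$ is a full (complement in the Riemann sphere connected), connected, compact set $K\subset\mathbb{C}$ with $0\in K$, $K\neq\{0\}$, such that $f$ and $f^{-1}$ extend univalently to a neighbourhood of $K$ and $f(K)=f^{-1}(K)=K$. A hedgehog of $f$ is a Siegel compact not contained in the closure of a linearization domain of $f$ (an open set containing $0$ on which $f$ is holomorphically conjugate to $R_\alpha$ on a disc centred at $0$); for nonlinearizable $f$, every Siegel compact is a hedgehog. *)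

theory Defs
  imports "HOL-Complex_Analysis.Complex_Analysis"
begin

definition rot :: "real \<Rightarrow> complex \<Rightarrow> complex" where
  "rot \<alpha> w = exp (2 * of_real pi * \<i> * of_real \<alpha>) * w"

definition linearizable :: "real \<Rightarrow> (complex \<Rightarrow> complex) \<Rightarrow> bool" where
  "linearizable \<alpha> f \<longleftrightarrow>
     (\<exists>r>0. \<exists>h. h holomorphic_on ball 0 r \<and> inj_on h (ball 0 r) \<and> h 0 = 0 \<and> deriv h 0 = 1 \<and>
        (\<forall>w\<in>ball 0 r. f (h w) = h (rot \<alpha> w)))"

definition same_germ0 :: "(complex \<Rightarrow> complex) \<Rightarrow> (complex \<Rightarrow> complex) \<Rightarrow> complex set \<Rightarrow> bool" where
  "same_germ0 g f V \<longleftrightarrow> (\<exists>e>0. ball 0 e \<subseteq> V \<and> (\<forall>z\<in>ball 0 e. g z = f z))"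

text \<open>Siegel compact: full, connected, compact, contains 0, not {0}, f extends univalently
  (hence f^-1 as well) to a neighbourhood of K, and f(K) = K (hence f^-1(K) = K).
  Fullness: complement in the Riemann sphere connected, which for compact K is
  equivalent to connectedness of the complement in C.\<close>
definition siegel_compact :: "(complex \<Rightarrow> complex) \<Rightarrow> complex set \<Rightarrow> bool" where
  "siegel_compact f K \<longleftrightarrow>
     compact K \<and> connected K \<and> connected (- K) \<and> 0 \<in> K \<and> K \<noteq> {0} \<and>
     (\<exists>V g. open V \<and> K \<subseteq> V \<and> g holomorphic_on V \<and> inj_on g V \<and> same_germ0 g f V \<and>
        g ` K = K \<and> inv_into V g ` K = K)"

definition lin_domain :: "real \<Rightarrow> (complex \<Rightarrow> complex) \<Rightarrow> complex set \<Rightarrow> bool" where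
  "lin_domain \<alpha> f \<Omega> \<longleftrightarrow>
     open \<Omega> \<and> 0 \<in> \<Omega> \<and>
     (\<exists>r>0. \<exists>\<phi> g. \<phi> holomorphic_on ball 0 r \<and> inj_on \<phi> (ball 0 r) \<and> \<phi> ` ball 0 r = \<Omega> \<and>
        \<phi> 0 = 0 \<and> g holomorphic_on \<Omega> \<and> same_germ0 g f \<Omega> \<and>
        (\<forall>w\<in>ball 0 r. g (\<phi> w) = \<phi> (rot \<alpha> w)))"

definition hedgehog :: "real \<Rightarrow> (complex \<Rightarrow> complex) \<Rightarrow> complex set \<Rightarrow> bool" where
  "hedgehog \<alpha> f K \<longleftrightarrow> siegel_compact f K \<and> \<not> (\<exists>\<Omega>. lin_domain \<alpha> f \<Omega> \<and> K \<subseteq> closure \<Omega>)"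

end

theory Submission
  imports Defs
begin

text \<open>
  Passing to the inverse germ, assume T(K) is contained in K, and suppose
  T(z) = z + b z^(k+1) + ... with b nonzero, k at least 1. Conjugating T by the iterates of f and
  composing, one obtains germs z + c z^(k+1) + ... mapping K into K, where c ranges over a set
  whose closure contains every sum of two numbers of modulus |b|. These germs push points of K
  in all directions, so the distance d(x) from x to K is o(|x|^(k+1)) near 0.

  On the other hand, d(x) / |x|^(k+1) is almost invariant: if x = u(x') for such a germ u, then
  d(x) / |x|^(k+1) is at most (1 + C |x'|^(k+1)) d(x') / |x'|^(k+1). Choosing u so that it moves x'
  away from 0, |x| exceeds |x'| by a multiple of |x'|^(k+1), and the factor is absorbed by the weight
  exp(- M |x|). A maximum of the weighted quotient over an annulus then contradicts the first bound
  unless d vanishes near 0. So K is a neighbourhood of 0, the iterates of f are a normal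
  family there, and averaging them linearizes f.
\<close>

subsection \<open>Germs fixing the origin\<close>

text \<open>In the coordinate -1/(k z^k) the germ z + c z^(k+1) + ... is translation by c up to an
  error that tends to 0, and |dz| becomes |dz| / |z|^(k+1). This is where the exponent comes from:
  d(x) / |x|^(k+1) is to first order the distance to K in that coordinate, and translations preserve
  distances. For the germ u itself this means that the terms of order |x|^k in u' and in
  (u(x)/x)^(k+1) cancel. The remaining error |x|^(k+1) has the order of the displacement of x, which
  is why a weight with M large enough can pay for it.

  Sums of two coefficients are taken because a single circle of coefficients only gives steps of one
  length, while approaching a given point also requires all shorter steps. Conjugation by f
  multiplies the coefficient by exp(2 pi i k \<alpha>), whose powers are dense in the unit
  circle.\<close>

lemma analytic_strict_difference:
  fixes f :: "complex \<Rightarrow> complex"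
  assumes "f analytic_on {a}" "e > 0"
  obtains d where "d > 0"
    "\<And>x y. \<lbrakk>x \<in> ball a d; y \<in> ball a d\<rbrakk> \<Longrightarrow> norm (f y - f x - deriv f a * (y - x)) \<le> e * norm (y - x)"
proof -
  obtain r where r: "r > 0" "f holomorphic_on ball a r"
    using assms(1) analytic_at_ball by blast
  have "continuous_on (ball a r) (deriv f)"
    using r by (intro holomorphic_on_imp_continuous_on holomorphic_deriv) auto
  then have "\<exists>d>0. \<forall>z. dist z a < d \<longrightarrow> dist (deriv f z) (deriv f a) < e"
    using r assms(2) continuous_at_eps_delta continuous_on_eq_continuous_at
    by (metis (no_types, lifting) centre_in_ball continuous_at_eps_delta open_ball)
  then obtain d0 where d0: "d0 > 0" "\<And>z. dist z a < d0 \<Longrightarrow> dist (deriv f z) (deriv f a) < e"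
    by blast
  define d where "d = min r d0"
  have "norm (f y - f x - deriv f a * (y - x)) \<le> e * norm (y - x)"
    if "x \<in> ball a d" "y \<in> ball a d" for x y
  proof -
    have "norm ((f y - deriv f a * y) - (f x - deriv f a * x)) \<le> e * norm (y - x)"
    proof (rule field_differentiable_bound[where S = "ball a d" and f' = "\<lambda>z. deriv f z - deriv f a"])
      fix z assume z: "z \<in> ball a d"
      then have "(f has_field_derivative deriv f z) (at z)"
        using r by (intro holomorphic_derivI[of f "ball a r"]) (auto simp: d_def)
      then show "((\<lambda>z. f z - deriv f a * z) has_field_derivative deriv f z - deriv f a)
          (at z within ball a d)"
        by (auto intro!: derivative_eq_intros intro: DERIV_subset)
      show "norm (deriv f z - deriv f a) \<le> e"
        using d0(2)[of z] z by (simp add: d_def dist_norm norm_minus_commute)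
    qed (use that in auto)
    then show ?thesis by (simp add: algebra_simps)
  qed
  moreover have "d > 0" using r d0 by (simp add: d_def)
  ultimately show ?thesis using that by blast
qed

lemma analytic_local_inverse:
  fixes f :: "complex \<Rightarrow> complex"
  assumes "f analytic_on {0}" "f 0 = 0" "deriv f 0 \<noteq> 0"
  obtains g where "g analytic_on {0}" "g 0 = 0" "deriv f 0 * deriv g 0 = 1"
    "\<forall>\<^sub>F z in nhds 0. f (g z) = z" "\<forall>\<^sub>F z in nhds 0. g (f z) = z"
proof -
  obtain S where S: "open S" "0 \<in> S" "f holomorphic_on S"
    using assms(1) analytic_at by blast
  obtain r where r: "r > 0" "ball 0 r \<subseteq> S" "open (f ` ball 0 r)" "inj_on f (ball 0 r)"
    using has_complex_derivative_locally_invertible[OF S(3,2,1) assms(3)] by blast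
  have hol: "f holomorphic_on ball 0 r" using S r holomorphic_on_subset by blast
  obtain g where g: "g holomorphic_on f ` ball 0 r"
    "\<And>z. z \<in> ball 0 r \<Longrightarrow> deriv f z * deriv g (f z) = 1" "\<And>z. z \<in> ball 0 r \<Longrightarrow> g (f z) = z"
    using holomorphic_has_inverse[OF hol open_ball r(4)] by blast
  have 0: "0 \<in> f ` ball 0 r" using assms(2) r(1) by (metis centre_in_ball image_eqI)
  show ?thesis
  proof
    show "g analytic_on {0}" using g(1) r(3) 0 analytic_at by blast
    show "g 0 = 0" "deriv f 0 * deriv g 0 = 1" using g(2,3)[of 0] assms(2) r(1) by auto
    show "\<forall>\<^sub>F z in nhds 0. f (g z) = z"
      using r(3) 0 g(3) unfolding eventually_nhds by (metis imageE)
    show "\<forall>\<^sub>F z in nhds 0. g (f z) = z"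
      using g(3) r(1) by (intro eventually_nhds_in_nhd[THEN eventually_mono, of 0 "ball 0 r"]) auto
  qed
qed

lemma analytic_at_zero_tendsto:
  fixes f :: "complex \<Rightarrow> complex"
  assumes "f analytic_on {0}" "f 0 = 0"
  shows "filterlim f (nhds 0) (nhds 0)"
  using analytic_at_imp_isCont[OF assms(1)] assms(2)
  by (metis isCont_def tendsto_at_iff_tendsto_nhds)

lemma analytic_at_zero_ratio:
  fixes f :: "complex \<Rightarrow> complex"
  assumes "f analytic_on {0}" "f 0 = 0"
  shows "((\<lambda>z. f z / z) \<longlongrightarrow> deriv f 0) (at 0)"
proof -
  have "(f has_field_derivative deriv f 0) (at 0)"
    using assms(1) analytic_on_imp_differentiable_at DERIV_deriv_iff_field_differentiable by blast
  then show ?thesis using assms(2) by (simp add: has_field_derivative_iff)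
qed

lemma analytic_at_zero_tendsto_at:
  fixes f :: "complex \<Rightarrow> complex"
  assumes "f analytic_on {0}" "f 0 = 0" "deriv f 0 \<noteq> 0"
  shows "filterlim f (at 0) (at 0)"
proof (rule filterlim_atI)
  show "(f \<longlongrightarrow> 0) (at 0)"
    using analytic_at_zero_tendsto[OF assms(1,2)] by (simp add: filterlim_mono at_within_le_nhds)
  have "\<forall>\<^sub>F z in at 0. f z / z \<noteq> 0"
    using tendsto_imp_eventually_ne[OF analytic_at_zero_ratio[OF assms(1,2)] assms(3)] .
  then show "\<forall>\<^sub>F z in at 0. f z \<noteq> 0" by eventually_elim auto
qed

lemma deriv_of_tangent:
  fixes u :: "complex \<Rightarrow> complex"
  assumes u: "u analytic_on {0}" "u 0 = 0" and "k \<ge> 1"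
    and lim: "((\<lambda>z. (u z - z) / z ^ Suc k) \<longlongrightarrow> \<beta>) (at 0)"
  shows "deriv u 0 = 1"
proof -
  have "((\<lambda>z. 1 + (u z - z) / z ^ Suc k * z ^ k) \<longlongrightarrow> 1 + \<beta> * 0 ^ k) (at 0)"
    by (intro tendsto_intros lim)
  moreover have "\<forall>\<^sub>F z in at (0::complex). 1 + (u z - z) / z ^ Suc k * z ^ k = u z / z"
    by (auto simp: eventually_at_filter field_simps)
  ultimately have "((\<lambda>z. u z / z) \<longlongrightarrow> 1) (at 0)"
    using \<open>k \<ge> 1\<close> by (simp add: tendsto_cong power_0_left)
  then show ?thesis
    using analytic_at_zero_ratio[OF u] tendsto_unique[OF at_neq_bot] by blast
qed

text \<open>Split u(v z) - z at v z: since v(z)/z tends to 1, the power of v z in the denominator of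
  the first part may be replaced by the power of z.\<close>

lemma tangent_compose:
  fixes u v :: "complex \<Rightarrow> complex"
  assumes u: "u analytic_on {0}" "u 0 = 0" and v: "v analytic_on {0}" "v 0 = 0" and "k \<ge> 1"
    and ul: "((\<lambda>z. (u z - z) / z ^ Suc k) \<longlongrightarrow> \<beta>) (at 0)"
    and vl: "((\<lambda>z. (v z - z) / z ^ Suc k) \<longlongrightarrow> \<gamma>) (at 0)"
  shows "((\<lambda>z. (u (v z) - z) / z ^ Suc k) \<longlongrightarrow> \<beta> + \<gamma>) (at 0)"
proof -
  have d: "deriv v 0 = 1" using deriv_of_tangent[OF v \<open>k \<ge> 1\<close> vl] .
  have va: "filterlim v (at 0) (at 0)" using analytic_at_zero_tendsto_at[OF v] d by simp
  have "((\<lambda>z. (u (v z) - v z) / (v z) ^ Suc k * (v z / z) ^ Suc k + (v z - z) / z ^ Suc k)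
     \<longlongrightarrow> \<beta> * 1 ^ Suc k + \<gamma>) (at 0)"
    using filterlim_compose[OF ul va] analytic_at_zero_ratio[OF v] d
    by (intro tendsto_intros vl) auto
  moreover have "\<forall>\<^sub>F z in at 0. v z \<noteq> 0 \<and> z \<noteq> 0"
    using va by (auto simp: filterlim_at eventually_conj_iff eventually_at_filter)
  then have "\<forall>\<^sub>F z in at 0. (u (v z) - v z) / (v z) ^ Suc k * (v z / z) ^ Suc k + (v z - z) / z ^ Suc k
     = (u (v z) - z) / z ^ Suc k"
  proof eventually_elim
    case (elim z)
    have "(u (v z) - v z) / (v z) ^ Suc k * (v z / z) ^ Suc k = (u (v z) - v z) / z ^ Suc k"
      using elim by (simp add: power_divide)
    then show ?case by (simp add: diff_divide_distrib)
  qed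
  ultimately show ?thesis by (simp add: tendsto_cong)
qed

text \<open>With y = g z, the increment h(u y) - h y is about h'(0) \<beta> y^(k+1), and y is about
  g'(0) z; the product g'(0) h'(0) = 1 removes one of the k+1 factors g'(0). The base point y moves
  and the increment is of order y^(k+1), so plain differentiability of h at 0 is too weak and the
  strict form is used.\<close>

lemma tangent_conjugate:
  fixes u g h :: "complex \<Rightarrow> complex"
  assumes u: "u analytic_on {0}" "u 0 = 0" and g: "g analytic_on {0}" "g 0 = 0"
    and h: "h analytic_on {0}" "h 0 = 0"
    and gh: "\<forall>\<^sub>F z in nhds 0. h (g z) = z" "deriv g 0 * deriv h 0 = 1"
    and ul: "((\<lambda>z. (u z - z) / z ^ Suc k) \<longlongrightarrow> \<beta>) (at 0)"
  shows "((\<lambda>z. (h (u (g z)) - z) / z ^ Suc k) \<longlongrightarrow> \<beta> * deriv g 0 ^ k) (at 0)"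
proof -
  define H where "H = deriv h 0"
  have g0: "deriv g 0 \<noteq> 0" using gh(2) by auto
  have ut: "filterlim u (nhds 0) (nhds 0)" using analytic_at_zero_tendsto[OF u] .
  have ga: "filterlim g (at 0) (at 0)" using analytic_at_zero_tendsto_at[OF g g0] .
  have *: "((\<lambda>y. (h (u y) - h y) / y ^ Suc k - H * ((u y - y) / y ^ Suc k)) \<longlongrightarrow> 0) (at 0)"
  proof (rule tendstoI)
    fix e :: real assume "e > 0"
    \<comment> \<open>The quotient multiplied by \<open>e'\<close> is eventually below
      \<open>norm \<beta> + 1\<close>; one more unit makes the final inequality strict and the
      denominator positive.\<close>
    define e' where "e' = e / (norm \<beta> + 2)"
    have b: "norm \<beta> + 2 > 0" by (smt (verit) norm_ge_zero)
    then have "e' > 0" using \<open>e > 0\<close> by (simp add: e'_def)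
    obtain d where d: "d > 0" "\<And>x y. \<lbrakk>x \<in> ball 0 d; y \<in> ball 0 d\<rbrakk>
        \<Longrightarrow> norm (h y - h x - deriv h 0 * (y - x)) \<le> e' * norm (y - x)"
      using analytic_strict_difference[OF h(1) \<open>e' > 0\<close>] by blast
    have 1: "\<forall>\<^sub>F y in at (0::complex). y \<in> ball 0 d"
      using d(1) by (intro eventually_at_in_open') auto
    have "\<forall>\<^sub>F y in nhds 0. u y \<in> ball 0 d"
      using eventually_compose_filterlim[OF eventually_nhds_in_open[of "ball 0 d"] ut] d(1) by simp
    then have 2: "\<forall>\<^sub>F y in at 0. u y \<in> ball 0 d" by (auto simp: eventually_at_filter elim: eventually_mono)
    have 3: "\<forall>\<^sub>F y in at 0. norm ((u y - y) / y ^ Suc k) < norm \<beta> + 1"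
      using order_tendstoD(2)[OF tendsto_norm[OF ul]] by simp
    have 4: "\<forall>\<^sub>F y in at (0::complex). y \<noteq> 0" by (simp add: eventually_at_filter)
    show "\<forall>\<^sub>F y in at 0. dist ((h (u y) - h y) / y ^ Suc k - H * ((u y - y) / y ^ Suc k)) 0 < e"
      using 1 2 3 4
    proof eventually_elim
      case (elim y)
      have "(h (u y) - h y) / y ^ Suc k - H * ((u y - y) / y ^ Suc k)
          = (h (u y) - h y - H * (u y - y)) / y ^ Suc k"
        using elim(4) by (simp add: field_simps)
      then have "norm ((h (u y) - h y) / y ^ Suc k - H * ((u y - y) / y ^ Suc k))
          = norm (h (u y) - h y - H * (u y - y)) / norm (y ^ Suc k)"
        by (simp add: norm_divide)
      also have "\<dots> \<le> e' * norm (u y - y) / norm (y ^ Suc k)"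
        using d(2)[OF elim(1,2)] by (intro divide_right_mono) (auto simp: H_def)
      also have "\<dots> = e' * norm ((u y - y) / y ^ Suc k)" by (simp add: norm_divide)
      also have "\<dots> \<le> e' * (norm \<beta> + 1)" using elim(3) \<open>e' > 0\<close> by (intro mult_left_mono) auto
      also have "\<dots> < e' * (norm \<beta> + 2)" using \<open>e' > 0\<close> by simp
      also have "\<dots> = e" using b by (simp add: e'_def)
      finally show ?case by simp
    qed
  qed
  have "((\<lambda>y. ((h (u y) - h y) / y ^ Suc k - H * ((u y - y) / y ^ Suc k)) + H * ((u y - y) / y ^ Suc k))
      \<longlongrightarrow> 0 + H * \<beta>) (at 0)"
    by (intro tendsto_add * tendsto_mult ul tendsto_const)
  then have "((\<lambda>y. (h (u y) - h y) / y ^ Suc k) \<longlongrightarrow> H * \<beta>) (at 0)" by simp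
  from filterlim_compose[OF this ga]
  have lim: "((\<lambda>z. (h (u (g z)) - h (g z)) / g z ^ Suc k * (g z / z) ^ Suc k)
     \<longlongrightarrow> H * \<beta> * deriv g 0 ^ Suc k) (at 0)"
    by (intro tendsto_intros analytic_at_zero_ratio g)
  have eq: "H * \<beta> * deriv g 0 ^ Suc k = \<beta> * deriv g 0 ^ k"
    using gh(2) by (simp add: H_def algebra_simps)
  have "\<forall>\<^sub>F z in at 0. g z \<noteq> 0 \<and> z \<noteq> 0 \<and> h (g z) = z"
    using ga gh(1) by (auto simp: filterlim_at eventually_conj_iff eventually_at_filter elim: eventually_mono)
  then have ev: "\<forall>\<^sub>F z in at 0. (h (u (g z)) - h (g z)) / g z ^ Suc k * (g z / z) ^ Suc k
      = (h (u (g z)) - z) / z ^ Suc k"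
    by eventually_elim (simp add: power_divide)
  show ?thesis using lim unfolding tendsto_cong[OF ev] eq .
qed

lemma irrational_rotation_dense:
  fixes \<theta> :: real and e :: complex
  assumes "\<theta> \<notin> \<rat>" "norm e = 1" "\<epsilon> > 0"
  shows "\<exists>n. norm (exp (2 * of_real pi * \<i> * of_real \<theta>) ^ n - e) < \<epsilon>"
proof -
  define t where "t = Arg e / (2 * pi)"
  have e: "e = cis (2 * pi * t)"
    using cis_Arg[of e] assms(2) by (cases "e = 0") (auto simp: t_def sgn_eq)
  \<comment> \<open>Kronecker's theorem approximates a point of [0,1], hence continuity at the
    fractional part of t; \<open>cis (2 * pi * s)\<close> has period 1 in s.\<close>
  have "isCont (\<lambda>s. cis (2 * pi * s)) (t - of_int \<lfloor>t\<rfloor>)"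
    by (auto simp: cis_conv_exp intro!: continuous_intros)
  then obtain d where d: "d > 0"
    "\<And>s. \<bar>s - frac t\<bar> < d \<Longrightarrow> norm (cis (2 * pi * s) - cis (2 * pi * frac t)) < \<epsilon>"
    using assms(3) by (auto simp: continuous_at_eps_delta dist_norm frac_def)
  obtain k where k: "k > 0" "\<bar>frac (real k * \<theta>) - frac t\<bar> < d"
    using Kronecker_approx_1_explicit[OF assms(1) _ _ d(1), of "frac t"]
    by (metis frac_ge_0 frac_lt_1 less_imp_le)
  have fr: "cis (2 * pi * frac x) = cis (2 * pi * x)" for x
  proof -
    have "cis (2 * pi * x) = cis (2 * pi * frac x) * cis (2 * pi * of_int \<lfloor>x\<rfloor>)"
      by (simp add: cis_mult frac_def algebra_simps)
    then show ?thesis by simp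
  qed
  have "exp (2 * of_real pi * \<i> * of_real \<theta>) ^ k = cis (2 * pi * (real k * \<theta>))"
    by (simp add: cis_conv_exp exp_of_nat_mult[symmetric] algebra_simps)
  then show ?thesis using d(2)[OF k(2)] fr e by metis
qed

subsection \<open>Density of an invariant compact set near the origin\<close>

text \<open>Invariance is required only near 0, so that local inverses qualify and compositions need
  no control of domains.\<close>

definition germ_into :: "complex set \<Rightarrow> (complex \<Rightarrow> complex) \<Rightarrow> bool" where
  "germ_into K u \<longleftrightarrow> u analytic_on {0} \<and> u 0 = 0 \<and> (\<forall>\<^sub>F z in nhds 0. z \<in> K \<longrightarrow> u z \<in> K)"

text \<open>The coefficient \<beta> may vanish, so cancelling sums of coefficients need no separate
  treatment.\<close>

definition tangent_germ :: "complex set \<Rightarrow> nat \<Rightarrow> complex \<Rightarrow> (complex \<Rightarrow> complex) \<Rightarrow> bool" where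
  "tangent_germ K k \<beta> u \<longleftrightarrow> germ_into K u \<and> ((\<lambda>z. (u z - z) / z ^ Suc k) \<longlongrightarrow> \<beta>) (at 0)"

text \<open>The net is drawn from B, here the coefficients that germs realise, although it
  approximates all of S. Finiteness lets one neighbourhood of 0 serve all the germs chosen.\<close>

lemma compact_finite_net:
  fixes S B :: "'a::metric_space set"
  assumes "compact S" "\<And>b. b \<in> S \<Longrightarrow> \<exists>c\<in>B. dist c b < e"
  obtains F where "F \<subseteq> B" "finite F" "\<And>b. b \<in> S \<Longrightarrow> \<exists>c\<in>F. dist c b < e"
proof -
  have "S \<subseteq> (\<Union>c\<in>B. ball c e)" using assms(2) by auto
  then obtain F where "F \<subseteq> B" "finite F" "S \<subseteq> (\<Union>c\<in>F. ball c e)"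
    using compactE_image[OF assms(1), of B "\<lambda>c. ball c e"] by (metis open_ball)
  show ?thesis
  proof
    fix b assume "b \<in> S"
    then have "b \<in> (\<Union>c\<in>F. ball c e)" using \<open>S \<subseteq> (\<Union>c\<in>F. ball c e)\<close> by (rule subsetD[rotated])
    then show "\<exists>c\<in>F. dist c b < e" unfolding UN_iff mem_ball .
  qed fact+
qed

lemma eventually_nhds_0_norm:
  "eventually P (nhds (0::'a::real_normed_vector)) \<longleftrightarrow> (\<exists>d>0. \<forall>z. norm z < d \<longrightarrow> P z)"
  by (simp add: eventually_nhds_metric)

text \<open>
  A nearest point y in K to x can be moved towards x by one of the germs, unless it is already
  very close; the rotations exclude that y = 0, which no germ moves.
\<close>

lemma infdist_invariant_compact:
  fixes K :: "complex set"
  assumes K: "compact K" "connected K" "0 \<in> K" "K \<noteq> {0}" and s: "s > 0"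
    and rot: "\<And>e \<epsilon>. \<lbrakk>norm e = 1; \<epsilon> > 0\<rbrakk> \<Longrightarrow> \<exists>g. germ_into K g \<and> dist (deriv g 0) e < \<epsilon>"
    and tan: "\<And>\<beta> \<epsilon>. \<lbrakk>norm \<beta> \<le> s; \<epsilon> > 0\<rbrakk> \<Longrightarrow> \<exists>\<gamma> u. dist \<gamma> \<beta> < \<epsilon> \<and> tangent_germ K k \<gamma> u"
    and \<epsilon>: "\<epsilon> > 0"
  shows "\<forall>\<^sub>F x in nhds 0. infdist x K \<le> \<epsilon> * norm x ^ Suc k"
proof -
  \<comment> \<open>Two errors of size \<open>\<epsilon>1 * norm y ^ Suc k\<close> will occur, one
    from the net and one from the remainder of the germ. They must stay below a full step of length
    \<open>s * norm y ^ Suc k\<close>, and below \<open>\<epsilon> * norm x ^ Suc k\<close>, where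
    \<open>norm y\<close> can be as large as \<open>2 * norm x\<close>.\<close>
  define \<epsilon>1 where "\<epsilon>1 = min (s / 4) (\<epsilon> / 2 ^ (k + 2))"
  have \<epsilon>1: "\<epsilon>1 > 0" "2 * \<epsilon>1 < s" "2 * \<epsilon>1 * 2 ^ Suc k \<le> \<epsilon>"
  proof -
    show "\<epsilon>1 > 0" "2 * \<epsilon>1 < s" using s \<epsilon> by (auto simp: \<epsilon>1_def)
    have "\<epsilon>1 \<le> \<epsilon> / 2 ^ (k + 2)" by (simp add: \<epsilon>1_def)
    then show "2 * \<epsilon>1 * 2 ^ Suc k \<le> \<epsilon>" by (simp add: field_simps)
  qed
  obtain F where F: "F \<subseteq> {\<gamma>. \<exists>u. tangent_germ K k \<gamma> u}" "finite F"
    "\<And>\<beta>. \<beta> \<in> cball 0 s \<Longrightarrow> \<exists>\<gamma>\<in>F. dist \<gamma> \<beta> < \<epsilon>1"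
  proof (rule compact_finite_net[of "cball (0::complex) s" "{\<gamma>. \<exists>u. tangent_germ K k \<gamma> u}" \<epsilon>1])
    fix \<beta> :: complex assume "\<beta> \<in> cball 0 s"
    then show "\<exists>\<gamma>\<in>{\<gamma>. \<exists>u. tangent_germ K k \<gamma> u}. dist \<gamma> \<beta> < \<epsilon>1"
      using tan[of \<beta> \<epsilon>1] \<epsilon>1(1) by auto
  qed auto
  from F(1) have "\<forall>\<gamma>\<in>F. \<exists>u. tangent_germ K k \<gamma> u" by auto
  then obtain U where U: "\<And>\<gamma>. \<gamma> \<in> F \<Longrightarrow> tangent_germ K k \<gamma> (U \<gamma>)" by metis
  have "\<forall>\<^sub>F z in nhds 0. (z \<in> K \<longrightarrow> U \<gamma> z \<in> K) \<and> norm (U \<gamma> z - z - \<gamma> * z ^ Suc k) \<le> \<epsilon>1 * norm z ^ Suc k"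
    if \<gamma>: "\<gamma> \<in> F" for \<gamma>
  proof -
    have U0: "U \<gamma> 0 = 0"
      using U[OF \<gamma>] unfolding tangent_germ_def germ_into_def by auto
    have "\<forall>\<^sub>F z in at 0. dist ((U \<gamma> z - z) / z ^ Suc k) \<gamma> < \<epsilon>1"
      using U[OF \<gamma>] \<epsilon>1(1) tendstoD unfolding tangent_germ_def by blast
    then have "\<forall>\<^sub>F z in nhds 0. z \<noteq> 0 \<longrightarrow> dist ((U \<gamma> z - z) / z ^ Suc k) \<gamma> < \<epsilon>1"
      by (simp add: eventually_at_filter)
    moreover have "\<forall>\<^sub>F z in nhds 0. z \<in> K \<longrightarrow> U \<gamma> z \<in> K"
      using U[OF \<gamma>] unfolding tangent_germ_def germ_into_def by auto
    ultimately show ?thesis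
    proof eventually_elim
      case (elim z)
      show ?case
      proof (cases "z = 0")
        case False
        then have "norm (U \<gamma> z - z - \<gamma> * z ^ Suc k)
            = dist ((U \<gamma> z - z) / z ^ Suc k) \<gamma> * norm z ^ Suc k"
        proof -
          have "U \<gamma> z - z - \<gamma> * z ^ Suc k = ((U \<gamma> z - z) / z ^ Suc k - \<gamma>) * z ^ Suc k"
            using False by (metis left_diff_distrib nonzero_eq_divide_eq power_not_zero)
          then show ?thesis by (simp only: dist_norm norm_mult norm_power)
        qed
        also have "\<dots> \<le> \<epsilon>1 * norm z ^ Suc k"
          using elim(1) False by (intro mult_right_mono) auto
        finally show ?thesis using elim by auto
      qed (use elim U0 in auto)
    qed
  qed
  then have "\<forall>\<^sub>F z in nhds 0. \<forall>\<gamma>\<in>F. (z \<in> K \<longrightarrow> U \<gamma> z \<in> K) \<and>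
      norm (U \<gamma> z - z - \<gamma> * z ^ Suc k) \<le> \<epsilon>1 * norm z ^ Suc k"
    using F(2) by (simp add: eventually_ball_finite_distrib)
  then obtain d1 where d1: "d1 > 0" "\<And>z \<gamma>. \<lbrakk>norm z < d1; \<gamma> \<in> F; z \<in> K\<rbrakk> \<Longrightarrow> U \<gamma> z \<in> K"
    "\<And>z \<gamma>. \<lbrakk>norm z < d1; \<gamma> \<in> F\<rbrakk> \<Longrightarrow> norm (U \<gamma> z - z - \<gamma> * z ^ Suc k) \<le> \<epsilon>1 * norm z ^ Suc k"
    unfolding eventually_nhds_0_norm by blast
  obtain R where R: "R \<subseteq> {c. \<exists>g. germ_into K g \<and> deriv g 0 = c}" "finite R"
    "\<And>e. e \<in> sphere 0 1 \<Longrightarrow> \<exists>c\<in>R. dist c e < 1/4"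
  proof (rule compact_finite_net[of "sphere (0::complex) 1" "{c. \<exists>g. germ_into K g \<and> deriv g 0 = c}" "1/4"])
    fix e :: complex assume "e \<in> sphere 0 1"
    then show "\<exists>c\<in>{c. \<exists>g. germ_into K g \<and> deriv g 0 = c}. dist c e < 1/4"
      using rot[of e "1/4"] by auto
  qed auto
  from R(1) have "\<forall>c\<in>R. \<exists>g. germ_into K g \<and> deriv g 0 = c" by auto
  then obtain G where G: "\<And>c. c \<in> R \<Longrightarrow> germ_into K (G c)" "\<And>c. c \<in> R \<Longrightarrow> deriv (G c) 0 = c" by metis
  have "\<forall>\<^sub>F z in nhds 0. (z \<in> K \<longrightarrow> G c z \<in> K) \<and> norm (G c z - c * z) \<le> 1/4 * norm z"
    if c: "c \<in> R" for c
  proof -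
    obtain d where d: "d > 0" "\<And>x y. \<lbrakk>x \<in> ball 0 d; y \<in> ball 0 d\<rbrakk> \<Longrightarrow>
        norm (G c y - G c x - deriv (G c) 0 * (y - x)) \<le> 1/4 * norm (y - x)"
      using analytic_strict_difference[of "G c" 0 "1/4"] G(1)[OF c] unfolding germ_into_def by auto
    have G0: "G c 0 = 0" using G(1)[OF c] by (auto simp: germ_into_def)
    have "\<forall>\<^sub>F z in nhds 0. z \<in> K \<longrightarrow> G c z \<in> K"
      using G(1)[OF c] by (auto simp: germ_into_def)
    moreover have "\<forall>\<^sub>F z in nhds (0::complex). z \<in> ball 0 d"
      using d(1) by (intro eventually_nhds_in_open) auto
    ultimately show ?thesis
    proof eventually_elim
      case (elim z)
      then show ?case using d(2)[of 0 z] d(1) G(2)[OF c] G0 by simp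
    qed
  qed
  then have "\<forall>\<^sub>F z in nhds 0. \<forall>c\<in>R. (z \<in> K \<longrightarrow> G c z \<in> K) \<and> norm (G c z - c * z) \<le> 1/4 * norm z"
    using R(2) by (simp add: eventually_ball_finite_distrib)
  then obtain d2 where d2: "d2 > 0" "\<And>z c. \<lbrakk>norm z < d2; c \<in> R; z \<in> K\<rbrakk> \<Longrightarrow> G c z \<in> K"
    "\<And>z c. \<lbrakk>norm z < d2; c \<in> R\<rbrakk> \<Longrightarrow> norm (G c z - c * z) \<le> 1/4 * norm z"
    unfolding eventually_nhds_0_norm by blast
  obtain p where p: "p \<in> K" "p \<noteq> 0" using K by blast
  \<comment> \<open>Connectedness of K gives a point of K on every small circle about 0, to which
    the rotations can be applied.\<close>
  have sph: "\<exists>y\<in>K. norm y = t" if "0 \<le> t" "t \<le> norm p" for t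
  proof -
    have "connected (norm ` K)" by (intro connected_continuous_image K continuous_intros)
    moreover have "0 \<in> norm ` K" "norm p \<in> norm ` K" using K p by force+
    ultimately have "t \<in> norm ` K" using that connectedD_interval by blast
    then show ?thesis by auto
  qed
  have "infdist x K \<le> \<epsilon> * norm x ^ Suc k" if x: "norm x < Min {d1 / 2, d2, norm p}" for x
  proof (cases "x = 0")
    case False
    \<comment> \<open>An approximate rotation takes \<open>y0\<close> to a point of K within
      \<open>norm x / 2\<close> of x, with one quarter of error from the net and one from
      nonlinearity. This beats the distance from x to 0, so a nearest point is not 0.\<close>
    obtain y0 where y0: "y0 \<in> K" "norm y0 = norm x" using sph[of "norm x"] x by auto
    then have "y0 \<noteq> 0" using False by auto
    have "x / y0 \<in> sphere 0 1" using y0 False by (simp add: norm_divide)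
    then obtain c where c: "c \<in> R" "dist c (x / y0) < 1/4" using R(3) by blast
    have "dist x (G c y0) < norm x"
    proof -
      have "norm (G c y0 - x) \<le> norm (G c y0 - c * y0) + norm (c * y0 - x)"
        using norm_triangle_ineq[of "G c y0 - c * y0" "c * y0 - x"] by simp
      also have "norm (c * y0 - x) = dist c (x / y0) * norm y0"
        using \<open>y0 \<noteq> 0\<close> norm_mult[of "c - x / y0" y0] by (simp add: dist_norm left_diff_distrib)
      also have "\<dots> \<le> 1/4 * norm y0" using c(2) by (intro mult_right_mono) auto
      also have "norm (G c y0 - c * y0) \<le> 1/4 * norm y0" using d2(3)[of y0 c] c(1) y0 x by simp
      finally have "norm (x - G c y0) \<le> norm x / 2" using y0 by (simp add: norm_minus_commute)
      moreover have "norm x > 0" using False by simp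
      ultimately show ?thesis unfolding dist_norm by linarith
    qed
    moreover have "G c y0 \<in> K" using d2(2)[of y0 c] y0 c x by simp
    moreover obtain y where y: "y \<in> K" "infdist x K = dist x y"
      using infdist_attains_inf[of K x] K by (metis compact_imp_closed empty_iff)
    ultimately have yx: "dist x y < norm x" using infdist_le[of "G c y0" K x] by linarith
    then have "y \<noteq> 0" by auto
    have "norm y \<le> norm x + norm (y - x)" using norm_triangle_ineq[of x "y - x"] by simp
    then have y2: "norm y \<le> 2 * norm x" using yx by (simp add: dist_norm norm_minus_commute)
    then have yd: "norm y < d1" using x by auto
    define r where "r = dist x y"
    define Y where "Y = y ^ Suc k"
    have Y0: "Y \<noteq> 0" using \<open>y \<noteq> 0\<close> by (simp add: Y_def)
    show ?thesis
    proof (rule ccontr)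
      assume "\<not> ?thesis"
      then have r: "r > \<epsilon> * norm x ^ Suc k" using y by (simp add: r_def)
      then have r0: "r > 0" using \<epsilon> False by (smt (verit) mult_pos_pos zero_less_norm_iff zero_less_power)
      have Yx: "2 * \<epsilon>1 * norm Y < r"
      proof -
        have "norm Y \<le> (2 * norm x) ^ Suc k"
          using y2 unfolding Y_def norm_power by (intro power_mono) auto
        then have "2 * \<epsilon>1 * norm Y \<le> 2 * \<epsilon>1 * (2 * norm x) ^ Suc k" using \<epsilon>1(1) by (intro mult_left_mono) auto
        also have "\<dots> = (2 * \<epsilon>1 * 2 ^ Suc k) * norm x ^ Suc k"
          by (simp only: power_mult_distrib mult.assoc)
        also have "\<dots> \<le> \<epsilon> * norm x ^ Suc k" using \<epsilon>1(3) by (intro mult_right_mono) auto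
        finally show ?thesis using r by linarith
      qed
      \<comment> \<open>The fraction of the segment from y to x that a coefficient of modulus at
        most s can cover. If t < 1 the gain \<open>t * r\<close> equals \<open>s * norm Y\<close>;
        if t = 1 it is r itself. Either exceeds the total error
        \<open>2 * \<epsilon>1 * norm Y\<close>.\<close>
      define t where "t = min 1 (s * norm Y / r)"
      have t: "0 < t" "t \<le> 1" using s Y0 r0 by (auto simp: t_def)
      define \<beta> where "\<beta> = of_real t * (x - y) / Y"
      have nxy: "norm (x - y) = r" by (simp add: r_def dist_norm)
      have "norm \<beta> = t * r / norm Y" using t by (simp add: \<beta>_def norm_mult norm_divide nxy)
      also have "\<dots> \<le> s" using Y0 r0 by (simp add: t_def min_def field_simps)
      finally obtain \<gamma> where \<gamma>: "\<gamma> \<in> F" "dist \<gamma> \<beta> < \<epsilon>1" using F(3)[of \<beta>] by auto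
      define z where "z = U \<gamma> y"
      have zK: "z \<in> K" using d1(2) yd \<gamma> y z_def by blast
      have "x - z = (1 - of_real t) * (x - y) - (\<gamma> - \<beta>) * Y - (U \<gamma> y - y - \<gamma> * Y)"
        using Y0 by (simp add: z_def \<beta>_def field_simps)
      also have "norm \<dots> \<le> norm ((1 - of_real t) * (x - y)) + norm ((\<gamma> - \<beta>) * Y) + norm (U \<gamma> y - y - \<gamma> * Y)"
        by (meson norm_triangle_ineq4 order_trans add_mono order_refl)
      also have "norm ((1 - of_real t) * (x - y)) = (1 - t) * r"
      proof -
        have "norm (1 - of_real t :: complex) = 1 - t"
          using t by (metis abs_of_nonneg diff_ge_0_iff_ge norm_of_real of_real_1 of_real_diff)
        then show ?thesis by (simp add: norm_mult nxy)
      qed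
      also have "norm ((\<gamma> - \<beta>) * Y) \<le> \<epsilon>1 * norm Y"
        using \<gamma>(2) by (simp add: norm_mult dist_norm mult_right_mono)
      also have "norm (U \<gamma> y - y - \<gamma> * Y) \<le> \<epsilon>1 * norm Y"
        using d1(3)[OF yd \<gamma>(1)] by (simp add: Y_def norm_power norm_mult)
      finally have *: "norm (x - z) \<le> (1 - t) * r + 2 * \<epsilon>1 * norm Y" by simp
      have "t * r > 2 * \<epsilon>1 * norm Y"
      proof (cases "s * norm Y / r \<le> 1")
        case True
        then have "t * r = s * norm Y" using r0 by (simp add: t_def min_absorb2)
        then show ?thesis using \<epsilon>1(2) Y0 by simp
      qed (use Yx in \<open>simp add: t_def\<close>)
      then have "dist x z < r" using * by (simp add: dist_norm algebra_simps)
      then show False using infdist_le[OF zK, of x] y r_def by simp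
    qed
  qed (use K in simp)
  then show ?thesis
    unfolding eventually_nhds_0_norm
    using d1(1) d2(1) p(2) by (intro exI[of _ "Min {d1 / 2, d2, norm p}"]) auto
qed

subsection \<open>The weighted distance\<close>

text \<open>A crude second-order binomial bound; the induction closes because 2 * 4^n + n is at most
  4^(n+1).\<close>

lemma norm_one_plus_power_le:
  fixes t :: complex
  assumes "norm t \<le> 1"
  shows "norm ((1 + t) ^ n - 1 - of_nat n * t) \<le> 4 ^ n * norm t ^ 2"
proof (induction n)
  case (Suc n)
  have "(1 + t) ^ Suc n - 1 - of_nat (Suc n) * t = (1 + t) * ((1 + t) ^ n - 1 - of_nat n * t) + of_nat n * t ^ 2"
    by (simp add: algebra_simps power2_eq_square)
  also have "norm \<dots> \<le> norm (1 + t) * norm ((1 + t) ^ n - 1 - of_nat n * t) + real n * norm t ^ 2"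
    by (rule norm_triangle_le) (simp add: norm_mult norm_power)
  also have "\<dots> \<le> 2 * (4 ^ n * norm t ^ 2) + 4 ^ n * norm t ^ 2"
  proof (intro add_mono mult_mono Suc.IH norm_ge_zero order_refl zero_le_power2)
    show "norm (1 + t) \<le> 2" using norm_triangle_ineq[of 1 t] assms by simp
    have "real n \<le> 2 ^ n" using of_nat_less_two_power[of n, where 'a=real] by simp
    also have "\<dots> \<le> (4::real) ^ n" by (intro power_mono) auto
    finally show "real n \<le> 4 ^ n" .
  qed simp_all
  also have "\<dots> \<le> 4 ^ Suc n * norm t ^ 2" by simp
  finally show ?case .
qed simp

lemma tangent_germ_factor:
  assumes u: "tangent_germ K k \<gamma> u"
  obtains q where "q analytic_on {0}" "q 0 = \<gamma>" "\<forall>\<^sub>F z in nhds 0. u z = z + z ^ Suc k * q z"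
proof -
  have ua: "u analytic_on {0}" "u 0 = 0" and lim: "((\<lambda>z. (u z - z) / z ^ Suc k) \<longlongrightarrow> \<gamma>) (at 0)"
    using u unfolding tangent_germ_def germ_into_def by blast+
  obtain r where r: "r > 0" "u holomorphic_on ball 0 r" using ua analytic_at_ball by blast
  define q where "q z = (if z = 0 then \<gamma> else (u z - z) / z ^ Suc k)" for z
  have "q holomorphic_on ball 0 r"
    unfolding q_def
  proof (rule removable_singularity)
    show "(\<lambda>z. (u z - z) / z ^ Suc k) holomorphic_on ball 0 r - {0}"
      by (intro holomorphic_intros holomorphic_on_subset[OF r(2)]) auto
    show "open (ball (0::complex) r)" by simp
    show "((\<lambda>z. (u z - z) / z ^ Suc k) \<longlongrightarrow> \<gamma>) (at 0)" by (rule lim)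
  qed
  then have "q analytic_on {0}" using r(1) analytic_at_ball by blast
  moreover have "u z = z + z ^ Suc k * q z" for z
    by (cases "z = 0") (simp_all add: q_def ua(2) del: power_Suc)
  then have "\<forall>\<^sub>F z in nhds 0. u z = z + z ^ Suc k * q z" by (intro always_eventually) blast
  moreover have "q 0 = \<gamma>" by (simp add: q_def)
  ultimately show ?thesis using that by blast
qed

text \<open>The derivative of u at x and (u(x)/x)^(k+1) both equal 1 + (k+1) x^k q(x) up to errors
  of order |x|^(k+1), the second because 2k is at least k+1. So the distance divided by the (k+1)-st
  power of the modulus changes by a factor 1 + O(|x|^(k+1)) only. The restriction on
  \<open>dist y x\<close> controls the terms quadratic in y - x. Multiplying out the quotients keeps
  x = 0 admissible.\<close>

lemma tangent_germ_distortion: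
  assumes q: "q analytic_on {0}" and k: "k \<ge> 1"
    and u: "\<forall>\<^sub>F z in nhds 0. u z = z + z ^ Suc k * q z"
  shows "\<exists>C\<ge>0. \<forall>\<^sub>F x in nhds 0. \<forall>y. dist y x \<le> norm x ^ Suc k \<longrightarrow>
    dist (u y) (u x) * norm x ^ Suc k \<le> dist y x * norm (u x) ^ Suc k * (1 + C * norm x ^ Suc k)"
proof -
  obtain d1 where d1: "d1 > 0" "\<And>z. norm z < d1 \<Longrightarrow> u z = z + z ^ Suc k * q z"
    using u unfolding eventually_nhds_0_norm by blast
  obtain d2 where d2: "d2 > 0" "\<And>x y. \<lbrakk>x \<in> ball 0 d2; y \<in> ball 0 d2\<rbrakk> \<Longrightarrow>
      norm (q y - q x - deriv q 0 * (y - x)) \<le> 1 * norm (y - x)"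
    using analytic_strict_difference[OF q, of 1] by auto
  define M where "M = norm (deriv q 0) + 1 + norm (q 0)"
  have M: "M \<ge> 1" by (simp add: M_def)
  have qlip: "norm (q y - q x) \<le> (norm (deriv q 0) + 1) * norm (y - x)"
    if "norm x < d2" "norm y < d2" for x y
    using d2(2)[of x y] that norm_triangle_ineq[of "q y - q x - deriv q 0 * (y - x)" "deriv q 0 * (y - x)"]
    by (simp add: norm_mult distrib_right)
  have qM: "norm (q y - q x) \<le> M * norm (y - x)" if "norm x < d2" "norm y < d2" for x y
    using qlip[OF that] mult_right_mono[of "norm (deriv q 0) + 1" M "norm (y - x)"] by (simp add: M_def)
  define n where "n = Suc k"
  \<comment> \<open>The parts come from the variation of q between x and y, from the binomial
    remainder \<open>\<rho>\<close>, and from replacing 1 + n \<sigma> by (1 + \<sigma>)^n.\<close>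
  define C0 where "C0 = M * (1 + real n + 4 ^ n) + 4 ^ n * M\<^sup>2"
  have C0: "C0 \<ge> 0" using M by (simp add: C0_def)
  \<comment> \<open>The halves leave room for y, as \<open>norm y \<le> 2 * norm x\<close>; the last
    entry gives \<open>norm \<sigma> \<le> 1 / 2\<close>.\<close>
  define d where "d = Min {d1 / 2, d2 / 2, 1 / (2 * M)}"
  have d: "d > 0" using d1 d2 M by (simp add: d_def)
  have "dist (u y) (u x) * norm x ^ n \<le> dist y x * norm (u x) ^ n * (1 + C0 * 2 ^ n * norm x ^ n)"
    if x: "norm x < d" and yx: "dist y x \<le> norm x ^ n" for x y
  proof (cases "x = 0")
    case False
    have xM: "norm x * M \<le> 1 / 2" using x M by (simp add: d_def field_simps)
    have xd: "2 * norm x < d1" "2 * norm x < d2" using x by (auto simp: d_def)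
    have x1: "norm x \<le> 1 / 2" using xM mult_left_mono[OF M, of "norm x"] by simp
    have xk: "norm x ^ k \<le> norm x" "norm x ^ Suc k \<le> norm x"
      using power_decreasing[of 1 k "norm x"] power_decreasing[of 1 "Suc k" "norm x"] x1 k by auto
    define t where "t = (y - x) / x"
    define \<sigma> where "\<sigma> = x ^ k * q x"
    define \<rho> where "\<rho> = (1 + t) ^ n - 1 - of_nat n * t"
    have yt: "y = x * (1 + t)" using False by (simp add: t_def field_simps)
    have nt: "dist y x = norm x * norm t" using False by (simp add: t_def dist_norm norm_divide)
    have "norm x * norm t \<le> norm x * norm x ^ k" using yx nt by (simp add: n_def)
    then have tk: "norm t \<le> norm x ^ k" using False by (simp add: mult_le_cancel_left)
    then have t1: "norm t \<le> 1" using xk x1 by linarith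
    have "norm y \<le> 2 * norm x"
      using norm_triangle_ineq[of 1 t] t1 mult_left_mono[of "norm (1 + t)" 2 "norm x"]
      by (simp add: yt norm_mult)
    then have yd: "norm y < d1" "norm y < d2" using xd by auto
    have nd: "norm x < d1" "norm x < d2" using xd norm_ge_zero[of x] by linarith+
    have qb: "norm (q z) \<le> M" if "norm z < d2" "norm z \<le> 1" for z
    proof -
      have "norm (q z) \<le> norm (q 0) + norm (q z - q 0)" using norm_triangle_ineq[of "q 0" "q z - q 0"] by simp
      also have "norm (q z - q 0) \<le> (norm (deriv q 0) + 1) * norm z" using qlip[of 0 z] that d2(1) by simp
      also have "\<dots> \<le> norm (deriv q 0) + 1" using that mult_left_mono[of "norm z" 1 "norm (deriv q 0) + 1"] by simp
      finally show ?thesis by (simp add: M_def)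
    qed
    have qx: "norm (q x) \<le> M" and qy: "norm (q y) \<le> M"
      using qb[of x] qb[of y] nd yd x1 \<open>norm y \<le> 2 * norm x\<close> by auto
    have \<sigma>M: "norm \<sigma> \<le> norm x ^ k * M" using qx by (simp add: \<sigma>_def norm_mult norm_power mult_left_mono)
    also have "\<dots> \<le> norm x * M" using xk M by (intro mult_right_mono) auto
    finally have \<sigma>2: "norm \<sigma> \<le> 1 / 2" using xM by linarith
    have xkk: "norm x ^ k * norm x ^ k \<le> norm x ^ n"
      using xk(1) by (simp add: n_def mult_right_mono)
    have ux: "u x = x * (1 + \<sigma>)" using d1(2)[OF nd(1)] by (simp add: \<sigma>_def algebra_simps)
    have uy: "u y = x * (1 + t) + x * x ^ k * (1 + t) ^ n * q y"
      using d1(2)[OF yd(1)] by (simp add: yt n_def power_mult_distrib)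
    have expand: "u y - u x = x * (t * (1 + of_nat n * \<sigma>)
        + x ^ k * ((q y - q x) * (1 + of_nat n * t) + \<rho> * q y))"
    proof -
      \<comment> \<open>The identity is polynomial once the powers and the values of q are treated
        as independent variables.\<close>
      have "x * (1 + t) + x * xk * p * qy' - x * (1 + xk * qx')
        = x * (t * (1 + m * (xk * qx')) + xk * ((qy' - qx') * (1 + m * t) + (p - 1 - m * t) * qy'))"
        for xk p qy' qx' m :: complex by algebra
      then show ?thesis unfolding uy ux \<rho>_def \<sigma>_def .
    qed
    have \<rho>: "norm \<rho> \<le> 4 ^ n * norm t ^ 2" unfolding \<rho>_def by (rule norm_one_plus_power_le[OF t1])
    have E1: "norm ((q y - q x) * (1 + of_nat n * t)) \<le> norm t * (M * (1 + real n) * norm x)"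
    proof -
      have "norm (q y - q x) \<le> M * (norm x * norm t)" using qM[OF nd(2) yd(2)] nt by (simp add: dist_norm)
      moreover have "norm (1 + of_nat n * t) \<le> 1 + real n"
        using norm_triangle_ineq[of 1 "of_nat n * t"] mult_left_mono[OF t1, of "real n"]
        by (simp add: norm_mult)
      ultimately have "norm (q y - q x) * norm (1 + of_nat n * t) \<le> (M * (norm x * norm t)) * (1 + real n)"
        by (intro mult_mono) (use M in auto)
      then show ?thesis by (simp only: norm_mult mult_ac)
    qed
    have E2: "norm (\<rho> * q y) \<le> norm t * (4 ^ n * M * norm x)"
    proof -
      have "norm (\<rho> * q y) \<le> (4 ^ n * norm t ^ 2) * M"
        using \<rho> qy by (simp add: norm_mult mult_mono)
      also have "\<dots> = norm t * (4 ^ n * M * norm t)" by (simp add: power2_eq_square)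
      also have "\<dots> \<le> norm t * (4 ^ n * M * norm x)"
        using tk xk M by (intro mult_left_mono) auto
      finally show ?thesis .
    qed
    \<comment> \<open>This is the cancellation: the linear factor of the increment is compared with
      (u(x)/x)^n. The error is of order |x|^(2k), at most |x|^n.\<close>
    have E3: "norm (1 + of_nat n * \<sigma>) \<le> norm (1 + \<sigma>) ^ n + 4 ^ n * M\<^sup>2 * norm x ^ n"
    proof -
      have "norm (1 + of_nat n * \<sigma>) \<le> norm ((1 + \<sigma>) ^ n) + norm ((1 + \<sigma>) ^ n - 1 - of_nat n * \<sigma>)"
        using norm_triangle_ineq4[of "(1 + \<sigma>) ^ n" "(1 + \<sigma>) ^ n - 1 - of_nat n * \<sigma>"] by simp
      also have "norm ((1 + \<sigma>) ^ n - 1 - of_nat n * \<sigma>) \<le> 4 ^ n * norm \<sigma> ^ 2"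
        using \<sigma>2 by (intro norm_one_plus_power_le) auto
      also have "norm \<sigma> ^ 2 \<le> (norm x ^ k * M) ^ 2" using \<sigma>M by (intro power_mono) auto
      also have "\<dots> = M\<^sup>2 * (norm x ^ k * norm x ^ k)" by (simp add: power2_eq_square)
      also have "\<dots> \<le> M\<^sup>2 * norm x ^ n" using xkk by (intro mult_left_mono) auto
      finally show ?thesis by (simp add: norm_power mult.assoc)
    qed
    have "dist (u y) (u x) = norm x * norm (t * (1 + of_nat n * \<sigma>)
        + x ^ k * ((q y - q x) * (1 + of_nat n * t) + \<rho> * q y))"
      unfolding dist_norm expand norm_mult ..
    also have "\<dots> \<le> norm x * (norm t * norm (1 + of_nat n * \<sigma>)
        + norm x ^ k * (norm ((q y - q x) * (1 + of_nat n * t)) + norm (\<rho> * q y)))"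
    proof (intro mult_left_mono norm_ge_zero)
      have "norm (a + x ^ k * (b + c)) \<le> norm a + norm x ^ k * (norm b + norm c)" for a b c :: complex
        using norm_triangle_ineq[of a "x ^ k * (b + c)"]
          mult_left_mono[OF norm_triangle_ineq[of b c], of "norm x ^ k"]
        by (simp add: norm_mult norm_power)
      then show "norm (t * (1 + of_nat n * \<sigma>) + x ^ k * ((q y - q x) * (1 + of_nat n * t) + \<rho> * q y))
        \<le> norm t * norm (1 + of_nat n * \<sigma>)
        + norm x ^ k * (norm ((q y - q x) * (1 + of_nat n * t)) + norm (\<rho> * q y))"
        by (metis norm_mult)
    qed
    also have "\<dots> \<le> norm x * (norm t * (norm (1 + \<sigma>) ^ n + 4 ^ n * M\<^sup>2 * norm x ^ n)
        + norm x ^ k * (norm t * (M * (1 + real n) * norm x) + norm t * (4 ^ n * M * norm x)))"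
      by (intro mult_left_mono add_mono E1 E2 E3) auto
    also have "\<dots> = dist y x * (norm (1 + \<sigma>) ^ n + C0 * norm x ^ n)"
      by (simp add: nt C0_def n_def algebra_simps)
    \<comment> \<open>Since \<open>norm (1 + \<sigma>)\<close> is at least 1/2, the additive error
      becomes a relative one at the cost of the factor 2^n.\<close>
    also have "\<dots> \<le> dist y x * (norm (1 + \<sigma>) ^ n + (2 * norm (1 + \<sigma>)) ^ n * (C0 * norm x ^ n))"
    proof -
      have "1 - norm \<sigma> \<le> norm (1 + \<sigma>)" using norm_triangle_ineq2[of 1 "-\<sigma>"] by simp
      then have "1 \<le> (2 * norm (1 + \<sigma>)) ^ n" using \<sigma>2 by (intro one_le_power) linarith
      then have "1 * (C0 * norm x ^ n) \<le> (2 * norm (1 + \<sigma>)) ^ n * (C0 * norm x ^ n)"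
        using C0 by (intro mult_right_mono) auto
      then show ?thesis by (intro mult_left_mono) auto
    qed
    also have "\<dots> = dist y x * norm (1 + \<sigma>) ^ n * (1 + C0 * 2 ^ n * norm x ^ n)"
      by (simp add: power_mult_distrib algebra_simps)
    finally have "dist (u y) (u x) * norm x ^ n
        \<le> dist y x * norm (1 + \<sigma>) ^ n * (1 + C0 * 2 ^ n * norm x ^ n) * norm x ^ n"
      by (intro mult_right_mono) auto
    also have "\<dots> = dist y x * norm (u x) ^ n * (1 + C0 * 2 ^ n * norm x ^ n)"
      by (simp add: ux norm_mult power_mult_distrib)
    finally show ?thesis .
  qed (simp add: n_def)
  then show ?thesis
    unfolding eventually_nhds_0_norm n_def[symmetric] using d C0
    by (intro exI[of _ "C0 * 2 ^ n"] conjI exI[of _ d]) auto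
qed

text \<open>Everything the maximum argument needs about one germ, phrased so that it can be chosen
  simultaneously for a finite net. The map v finds the point that u sends to a given x, and Q is
  \<gamma> with the higher-order terms absorbed. The tolerance 1/8 feeds the lower bound on a real
  part in \<open>infdist_potential_increases\<close>.\<close>

lemma tangent_germ_local_form:
  assumes u: "tangent_germ K k \<gamma> u" and k: "k \<ge> 1" and s: "s > 0"
  shows "\<exists>C v. C \<ge> 0 \<and> filterlim v (nhds 0) (nhds 0) \<and> (\<forall>\<^sub>F x in nhds 0. u (v x) = x) \<and>
    (\<forall>\<^sub>F z in nhds 0. (z \<in> K \<longrightarrow> u z \<in> K) \<and>
      (\<exists>Q. u z = z * (1 + z ^ k * Q) \<and> norm (Q - \<gamma>) \<le> s) \<and>
      norm (z ^ k - u z ^ k) \<le> norm z ^ k / 8 \<and>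
      (\<forall>y. dist y z \<le> norm z ^ Suc k \<longrightarrow>
        dist (u y) (u z) * norm z ^ Suc k \<le> dist y z * norm (u z) ^ Suc k * (1 + C * norm z ^ Suc k)))"
proof -
  have ua: "u analytic_on {0}" "u 0 = 0" and uK: "\<forall>\<^sub>F z in nhds 0. z \<in> K \<longrightarrow> u z \<in> K"
    and lim: "((\<lambda>z. (u z - z) / z ^ Suc k) \<longlongrightarrow> \<gamma>) (at 0)"
    using u unfolding tangent_germ_def germ_into_def by blast+
  have d: "deriv u 0 = 1" by (rule deriv_of_tangent[OF ua k lim])
  obtain v where v: "v analytic_on {0}" "v 0 = 0" "\<forall>\<^sub>F z in nhds 0. u (v z) = z"
    using analytic_local_inverse[OF ua] d by (metis one_neq_zero)
  obtain q where q: "q analytic_on {0}" "q 0 = \<gamma>" "\<forall>\<^sub>F z in nhds 0. u z = z + z ^ Suc k * q z"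
    using tangent_germ_factor[OF u] by blast
  obtain C where C: "C \<ge> 0" "\<forall>\<^sub>F z in nhds 0. \<forall>y. dist y z \<le> norm z ^ Suc k \<longrightarrow>
      dist (u y) (u z) * norm z ^ Suc k \<le> dist y z * norm (u z) ^ Suc k * (1 + C * norm z ^ Suc k)"
    using tangent_germ_distortion[OF q(1) k q(3)] by blast
  have "filterlim q (nhds \<gamma>) (nhds 0)"
    using analytic_at_imp_isCont[OF q(1)] q(2) by (metis isCont_def tendsto_at_iff_tendsto_nhds)
  then have "\<forall>\<^sub>F z in nhds 0. dist (q z) \<gamma> < s" using s tendstoD by blast
  with q(3) have Q: "\<forall>\<^sub>F z in nhds 0. \<exists>Q. u z = z * (1 + z ^ k * Q) \<and> norm (Q - \<gamma>) \<le> s"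
  proof eventually_elim
    case (elim z)
    then show ?case by (intro exI[of _ "q z"]) (simp add: dist_norm algebra_simps)
  qed
  have "((\<lambda>z. (u z / z) ^ k) \<longlongrightarrow> 1 ^ k) (at 0)"
    using analytic_at_zero_ratio[OF ua] d by (intro tendsto_intros) simp
  then have "\<forall>\<^sub>F z in at 0. dist ((u z / z) ^ k) 1 < 1 / 8" by (intro tendstoD) auto
  then have "\<forall>\<^sub>F z in nhds 0. z \<noteq> 0 \<longrightarrow> dist ((u z / z) ^ k) 1 < 1 / 8"
    by (simp add: eventually_at_filter)
  then have "\<forall>\<^sub>F z in nhds 0. norm (z ^ k - u z ^ k) \<le> norm z ^ k / 8"
  proof eventually_elim
    case (elim z)
    show ?case
    proof (cases "z = 0")
      case False
      then have "z ^ k - u z ^ k = - (((u z / z) ^ k - 1) * z ^ k)"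
        by (simp add: power_divide left_diff_distrib)
      then have "norm (z ^ k - u z ^ k) = norm ((u z / z) ^ k - 1) * norm z ^ k"
        by (simp only: norm_minus_cancel norm_mult norm_power)
      also have "\<dots> \<le> 1 / 8 * norm z ^ k"
        using elim False by (intro mult_right_mono) (auto simp: dist_norm)
      finally show ?thesis by simp
    qed (use k ua in \<open>simp add: power_0_left\<close>)
  qed
  with uK Q C(2) have "\<forall>\<^sub>F z in nhds 0. (z \<in> K \<longrightarrow> u z \<in> K) \<and>
      (\<exists>Q. u z = z * (1 + z ^ k * Q) \<and> norm (Q - \<gamma>) \<le> s) \<and>
      norm (z ^ k - u z ^ k) \<le> norm z ^ k / 8 \<and>
      (\<forall>y. dist y z \<le> norm z ^ Suc k \<longrightarrow>
        dist (u y) (u z) * norm z ^ Suc k \<le> dist y z * norm (u z) ^ Suc k * (1 + C * norm z ^ Suc k))"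
    by (intro eventually_conj)
  with C(1) v(3) analytic_at_zero_tendsto[OF v(1,2)] show ?thesis by blast
qed

lemma norm_one_plus_ge_one_plus_Re: "1 + Re w \<le> norm (1 + w)"
  using complex_Re_le_cmod[of "1 + w"] by simp

text \<open>The point x is pulled back to x' by a local inverse, but the nearest point of K to x' is
  pushed forward by the germ, so forward invariance of K suffices. The hypothesis
  \<open>small\<close> puts that nearest point within the range of the distortion estimate.\<close>

lemma infdist_potential_increases:
  fixes K :: "complex set"
  assumes K: "compact K" "0 \<in> K" and k: "k \<ge> 1" and s: "s > 0"
    and tan: "\<And>\<beta> \<epsilon>. \<lbrakk>norm \<beta> \<le> s; \<epsilon> > 0\<rbrakk> \<Longrightarrow> \<exists>\<gamma> u. dist \<gamma> \<beta> < \<epsilon> \<and> tangent_germ K k \<gamma> u"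
    and small: "\<forall>\<^sub>F x in nhds 0. infdist x K \<le> norm x ^ Suc k"
  shows "\<exists>M. \<forall>\<^sub>F x in nhds 0. infdist x K > 0 \<longrightarrow> (\<exists>x'. 0 < norm x' \<and> norm x' < norm x \<and>
    infdist x K / norm x ^ Suc k * exp (- M * norm x) < infdist x' K / norm x' ^ Suc k * exp (- M * norm x'))"
proof -
  define n where "n = Suc k"
  obtain F where F: "F \<subseteq> {\<gamma>. \<exists>u. tangent_germ K k \<gamma> u}" "finite F"
    "\<And>\<beta>. \<beta> \<in> cball 0 s \<Longrightarrow> \<exists>\<gamma>\<in>F. dist \<gamma> \<beta> < s / 8"
  proof (rule compact_finite_net[of "cball (0::complex) s" "{\<gamma>. \<exists>u. tangent_germ K k \<gamma> u}" "s / 8"])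
    fix \<beta> :: complex assume "\<beta> \<in> cball 0 s"
    then show "\<exists>\<gamma>\<in>{\<gamma>. \<exists>u. tangent_germ K k \<gamma> u}. dist \<gamma> \<beta> < s / 8"
      using tan[of \<beta> "s / 8"] s by auto
  qed auto
  define P where "P u C \<gamma> z \<longleftrightarrow> (z \<in> K \<longrightarrow> u z \<in> K) \<and>
      (\<exists>Q. u z = z * (1 + z ^ k * Q) \<and> norm (Q - \<gamma>) \<le> s / 8) \<and>
      norm (z ^ k - u z ^ k) \<le> norm z ^ k / 8 \<and>
      (\<forall>y. dist y z \<le> norm z ^ n \<longrightarrow>
        dist (u y) (u z) * norm z ^ n \<le> dist y z * norm (u z) ^ n * (1 + C * norm z ^ n))"
    for u :: "complex \<Rightarrow> complex" and C \<gamma> z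
  have "\<forall>\<gamma>\<in>F. \<exists>u C v. C \<ge> 0 \<and> filterlim v (nhds 0) (nhds 0) \<and> (\<forall>\<^sub>F x in nhds 0. u (v x) = x) \<and>
    (\<forall>\<^sub>F z in nhds 0. P u C \<gamma> z)"
  proof
    fix \<gamma> assume "\<gamma> \<in> F"
    then obtain u where "tangent_germ K k \<gamma> u" using F(1) by blast
    from tangent_germ_local_form[OF this k, of "s / 8"] s
    show "\<exists>u C v. C \<ge> 0 \<and> filterlim v (nhds 0) (nhds 0) \<and> (\<forall>\<^sub>F x in nhds 0. u (v x) = x) \<and>
      (\<forall>\<^sub>F z in nhds 0. P u C \<gamma> z)" unfolding P_def n_def by (intro exI[of _ u]) simp
  qed
  from bchoice[OF this] obtain U where "\<forall>\<gamma>\<in>F. \<exists>C v. C \<ge> 0 \<and> filterlim v (nhds 0) (nhds 0) \<and>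
    (\<forall>\<^sub>F x in nhds 0. U \<gamma> (v x) = x) \<and> (\<forall>\<^sub>F z in nhds 0. P (U \<gamma>) C \<gamma> z)" by blast
  from bchoice[OF this] obtain C where "\<forall>\<gamma>\<in>F. \<exists>v. C \<gamma> \<ge> 0 \<and> filterlim v (nhds 0) (nhds 0) \<and>
    (\<forall>\<^sub>F x in nhds 0. U \<gamma> (v x) = x) \<and> (\<forall>\<^sub>F z in nhds 0. P (U \<gamma>) (C \<gamma>) \<gamma> z)" by blast
  from bchoice[OF this] obtain V where UCV: "\<And>\<gamma>. \<gamma> \<in> F \<Longrightarrow> C \<gamma> \<ge> (0::real)"
    "\<And>\<gamma>. \<gamma> \<in> F \<Longrightarrow> filterlim (V \<gamma>) (nhds 0) (nhds (0::complex))"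
    "\<And>\<gamma>. \<gamma> \<in> F \<Longrightarrow> \<forall>\<^sub>F x in nhds 0. U \<gamma> (V \<gamma> x) = x"
    "\<And>\<gamma>. \<gamma> \<in> F \<Longrightarrow> \<forall>\<^sub>F z in nhds 0. P (U \<gamma>) (C \<gamma>) \<gamma> z"
    by blast
  have "\<forall>\<^sub>F z in nhds 0. infdist z K \<le> norm z ^ n \<and> (\<forall>\<gamma>\<in>F. P (U \<gamma>) (C \<gamma>) \<gamma> z)"
    using UCV(4) F(2) small by (simp add: eventually_ball_finite_distrib eventually_conj_iff n_def)
  then obtain d where d: "d > 0" "\<And>z. norm z < d \<Longrightarrow> infdist z K \<le> norm z ^ n"
    "\<And>z \<gamma>. \<lbrakk>norm z < d; \<gamma> \<in> F\<rbrakk> \<Longrightarrow> P (U \<gamma>) (C \<gamma>) \<gamma> z"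
    unfolding eventually_nhds_0_norm by blast
  \<comment> \<open>Half of d leaves room for a nearest point of K, of norm at most
    \<open>2 * norm z\<close>; the bound 1 gives \<open>norm z ^ n \<le> norm z\<close>.\<close>
  define d' where "d' = min (d / 2) 1"
  have "d' > 0" using d(1) by (simp add: d'_def)
  then have ev: "\<forall>\<^sub>F x in nhds 0. \<forall>\<gamma>\<in>F. U \<gamma> (V \<gamma> x) = x \<and> dist (V \<gamma> x) 0 < d'"
    using F(2) UCV(3) tendstoD[OF UCV(2), of _ d']
    by (auto simp: eventually_ball_finite_distrib eventually_conj_iff)
  define Cm where "Cm = sum C F"
  have Cm: "C \<gamma> \<le> Cm" if "\<gamma> \<in> F" for \<gamma>
    unfolding Cm_def by (rule member_le_sum[OF that]) (use UCV(1) F(2) in auto)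
  \<comment> \<open>The norm will grow by at least \<open>s / 2 * norm z ^ n\<close>, so the weight
    contributes \<open>exp (- (Cm + 1) * norm z ^ n)\<close>, which beats every factor
    \<open>1 + C \<gamma> * norm z ^ n\<close>.\<close>
  define M where "M = (Cm + 1) * 2 / s"
  from ev have "\<forall>\<^sub>F x in nhds 0. infdist x K > 0 \<longrightarrow> (\<exists>x'. 0 < norm x' \<and> norm x' < norm x \<and>
    infdist x K / norm x ^ n * exp (- M * norm x) < infdist x' K / norm x' ^ n * exp (- M * norm x'))"
  proof eventually_elim
    case (elim x)
    show ?case
    proof
      assume D: "infdist x K > 0"
      then have x0: "x \<noteq> 0" using K by auto
      \<comment> \<open>With this coefficient the inverse germ moves x towards 0.\<close>
      define \<beta> where "\<beta> = of_real (s * norm x ^ k) / x ^ k"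
      have n\<beta>: "norm \<beta> = s" using x0 s by (simp add: \<beta>_def norm_divide norm_mult norm_power)
      then obtain \<gamma> where \<gamma>: "\<gamma> \<in> F" "dist \<gamma> \<beta> < s / 8" using F(3)[of \<beta>] by auto
      define z where "z = V \<gamma> x"
      have Uz: "U \<gamma> z = x" and zd: "norm z < d / 2" "norm z < 1"
        using elim \<gamma>(1) by (auto simp: z_def d'_def)
      have zd': "norm z < d" using zd d(1) by linarith
      note Pz = d(3)[OF zd' \<gamma>(1), unfolded P_def Uz]
      obtain Q where Q: "x = z * (1 + z ^ k * Q)" "norm (Q - \<gamma>) \<le> s / 8" using Pz by blast
      have z0: "z \<noteq> 0" using Q(1) x0 by auto
      have nz: "norm z > 0" using z0 by simp
      have xz: "norm (z ^ k - x ^ k) \<le> norm z ^ k / 8" using Pz by blast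
      \<comment> \<open>The main term \<open>\<beta> * x ^ k\<close> is the positive real
        \<open>s * norm x ^ k\<close>, at least 7/8 of \<open>s * norm z ^ k\<close>. Replacing Q by
        \<beta> costs 1/4 and z^k by x^k costs 1/8, which leaves 1/2.\<close>
      have Re: "Re (z ^ k * Q) \<ge> s / 2 * norm z ^ k"
      proof -
        have "norm ((Q - \<beta>) * z ^ k) \<le> s / 4 * norm z ^ k"
        proof -
          have "norm (Q - \<beta>) \<le> s / 4"
            using norm_triangle_ineq[of "Q - \<gamma>" "\<gamma> - \<beta>"] Q(2) \<gamma>(2) by (simp add: dist_norm)
          then show ?thesis by (simp only: norm_mult norm_power mult_right_mono zero_le_power norm_ge_zero)
        qed
        then have 1: "Re ((Q - \<beta>) * z ^ k) \<ge> - (s / 4 * norm z ^ k)"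
          using abs_Re_le_cmod[of "(Q - \<beta>) * z ^ k"] by linarith
        have "norm (\<beta> * (z ^ k - x ^ k)) \<le> s * (norm z ^ k / 8)"
          using xz s by (simp add: norm_mult n\<beta> mult_left_mono del: mult_le_cancel_left_pos)
        then have 2: "Re (\<beta> * (z ^ k - x ^ k)) \<ge> - (s * norm z ^ k / 8)"
          using abs_Re_le_cmod[of "\<beta> * (z ^ k - x ^ k)"] by (simp add: algebra_simps)
        have "\<beta> * x ^ k = of_real (s * norm x ^ k)" using x0 by (simp add: \<beta>_def)
        then have 3: "Re (\<beta> * x ^ k) = s * norm x ^ k" by (metis Re_complex_of_real)
        have "norm z ^ k - norm x ^ k \<le> norm z ^ k / 8"
          using norm_triangle_ineq2[of "z ^ k" "x ^ k"] xz by (simp add: norm_power)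
        then have "7 / 8 * norm z ^ k \<le> norm x ^ k" by simp
        then have 4: "s * norm x ^ k \<ge> s * (7 / 8 * norm z ^ k)"
          using s by (intro mult_left_mono) auto
        have "z ^ k * Q = (Q - \<beta>) * z ^ k + \<beta> * (z ^ k - x ^ k) + \<beta> * x ^ k" by (simp add: algebra_simps)
        then have "Re (z ^ k * Q) = Re ((Q - \<beta>) * z ^ k) + Re (\<beta> * (z ^ k - x ^ k)) + Re (\<beta> * x ^ k)"
          by (metis plus_complex.simps(1))
        then show ?thesis using 1 2 3 4 mult_pos_pos[OF s, of "norm z ^ k"] nz by simp
      qed
      have "norm x = norm z * norm (1 + z ^ k * Q)" using Q(1) by (metis norm_mult)
      also have "\<dots> \<ge> norm z * (1 + s / 2 * norm z ^ k)"
        using norm_one_plus_ge_one_plus_Re[of "z ^ k * Q"] Re by (intro mult_left_mono) auto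
      finally have grow: "norm x \<ge> norm z + s / 2 * norm z ^ n" by (simp add: n_def algebra_simps)
      have zn: "norm z ^ n > 0" using nz by simp
      then have less: "norm z < norm x" using grow mult_pos_pos[OF s zn] by simp
      obtain y where y: "y \<in> K" "infdist z K = dist z y"
        using infdist_attains_inf[of K z] K by (metis compact_imp_closed empty_iff)
      have yz: "dist y z \<le> norm z ^ n" using d(2)[OF zd'] y by (simp add: dist_commute)
      also have "\<dots> \<le> norm z" using power_decreasing[of 1 n "norm z"] zd by (simp add: n_def)
      finally have "norm y \<le> 2 * norm z" using norm_triangle_ineq[of z "y - z"] by (simp add: dist_norm)
      then have "norm y < d" using zd by simp
      then have "U \<gamma> y \<in> K" using d(3) \<gamma>(1) y(1) unfolding P_def by blast
      then have "infdist x K \<le> dist (U \<gamma> y) x" by (metis infdist_le dist_commute)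
      then have "infdist x K * norm z ^ n \<le> dist (U \<gamma> y) x * norm z ^ n" by (intro mult_right_mono) auto
      also have "\<dots> \<le> infdist z K * norm x ^ n * (1 + C \<gamma> * norm z ^ n)"
        using Pz yz y(2) by (simp add: dist_commute)
      finally have main: "infdist x K / norm x ^ n \<le> infdist z K / norm z ^ n * (1 + C \<gamma> * norm z ^ n)"
        using x0 z0 by (simp add: field_simps)
      define D' where "D' = infdist z K / norm z ^ n"
      have D'0: "D' \<ge> 0" by (simp add: D'_def infdist_nonneg)
      \<comment> \<open>If z lay at distance 0 from K, the estimate \<open>main\<close> would force
        the same for x. Positivity is needed for the strict inequality below.\<close>
      moreover have "D' \<noteq> 0"
      proof
        assume "D' = 0"
        then have "infdist x K / norm x ^ n \<le> 0" using main by (simp add: D'_def[symmetric])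
        moreover have "infdist x K / norm x ^ n > 0" using D x0 by simp
        ultimately show False by linarith
      qed
      ultimately have D': "D' > 0" by simp
      have "M * norm x \<ge> M * (norm z + s / 2 * norm z ^ n)"
        using grow UCV(1) s by (intro mult_left_mono) (auto simp: M_def Cm_def intro!: divide_nonneg_pos add_nonneg_nonneg sum_nonneg)
      also have "M * (norm z + s / 2 * norm z ^ n) = M * norm z + (Cm + 1) * norm z ^ n"
        using s by (simp add: M_def field_simps)
      finally have "exp (- M * norm x) \<le> exp (- M * norm z) * exp (- (Cm + 1) * norm z ^ n)"
        by (simp add: exp_add[symmetric] algebra_simps)
      with main have "infdist x K / norm x ^ n * exp (- M * norm x)
          \<le> (D' * (1 + C \<gamma> * norm z ^ n)) * (exp (- M * norm z) * exp (- (Cm + 1) * norm z ^ n))"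
        unfolding D'_def[symmetric] using D'0 UCV(1)[OF \<gamma>(1)] by (intro mult_mono) auto
      also have "\<dots> = D' * exp (- M * norm z) * ((1 + C \<gamma> * norm z ^ n) * exp (- (Cm + 1) * norm z ^ n))"
        by simp
      also have "\<dots> < D' * exp (- M * norm z) * 1"
      proof (rule mult_strict_left_mono)
        have "1 + C \<gamma> * norm z ^ n \<le> exp (C \<gamma> * norm z ^ n)" by (rule exp_ge_add_one_self)
        also have "\<dots> < exp ((Cm + 1) * norm z ^ n)"
          using mult_strict_right_mono[OF _ zn, of "C \<gamma>" "Cm + 1"] Cm[OF \<gamma>(1)] by simp
        finally have "(1 + C \<gamma> * norm z ^ n) / exp ((Cm + 1) * norm z ^ n) < 1"
          by (simp add: divide_less_eq_1_pos del: divide_less_eq_1)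
        then show "(1 + C \<gamma> * norm z ^ n) * exp (- (Cm + 1) * norm z ^ n) < 1"
          by (simp only: exp_minus mult_minus_left divide_inverse)
      qed (use D' in simp)
      finally show "\<exists>x'. 0 < norm x' \<and> norm x' < norm x \<and>
        infdist x K / norm x ^ n * exp (- M * norm x) < infdist x' K / norm x' ^ n * exp (- M * norm x')"
        using nz less unfolding D'_def by (intro exI[of _ z]) simp
    qed
  qed
  then show ?thesis unfolding n_def by blast
qed

lemma invariant_compact_contains_nhd:
  fixes K :: "complex set"
  assumes K: "compact K" "connected K" "0 \<in> K" "K \<noteq> {0}" and k: "k \<ge> 1" and s: "s > 0"
    and rot: "\<And>e \<epsilon>. \<lbrakk>norm e = 1; \<epsilon> > 0\<rbrakk> \<Longrightarrow> \<exists>g. germ_into K g \<and> dist (deriv g 0) e < \<epsilon>"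
    and tan: "\<And>\<beta> \<epsilon>. \<lbrakk>norm \<beta> \<le> s; \<epsilon> > 0\<rbrakk> \<Longrightarrow> \<exists>\<gamma> u. dist \<gamma> \<beta> < \<epsilon> \<and> tangent_germ K k \<gamma> u"
  shows "0 \<in> interior K"
proof -
  have small: "\<forall>\<^sub>F x in nhds 0. infdist x K \<le> \<epsilon> * norm x ^ Suc k" if "\<epsilon> > 0" for \<epsilon>
    using infdist_invariant_compact[OF K s rot tan that] .
  obtain M where step: "\<forall>\<^sub>F x in nhds 0. infdist x K > 0 \<longrightarrow> (\<exists>x'. 0 < norm x' \<and> norm x' < norm x \<and>
    infdist x K / norm x ^ Suc k * exp (- M * norm x) < infdist x' K / norm x' ^ Suc k * exp (- M * norm x'))"
    using infdist_potential_increases[OF K(1,3) k s tan] small[of 1] by auto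
  define \<Phi> where "\<Phi> x = infdist x K / norm x ^ Suc k * exp (- M * norm x)" for x
  from step obtain r where r: "r > 0" "\<And>x. \<lbrakk>norm x < r; infdist x K > 0\<rbrakk> \<Longrightarrow>
      \<exists>x'. 0 < norm x' \<and> norm x' < norm x \<and> \<Phi> x < \<Phi> x'"
    unfolding eventually_nhds_0_norm \<Phi>_def by blast
  have "x0 \<in> K" if x0: "norm x0 < r" for x0
  proof (rule ccontr)
    assume nK: "x0 \<notin> K"
    then have "infdist x0 K > 0"
      using K by (metis compact_imp_closed empty_iff in_closed_iff_infdist_zero infdist_nonneg order_le_less)
    moreover have "x0 \<noteq> 0" using nK K by auto
    ultimately have P0: "\<Phi> x0 > 0" by (simp add: \<Phi>_def)
    \<comment> \<open>Chosen so that near 0 the weighted quotient is at most half of its value at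
      \<open>x0\<close>; the absolute value is there because the sign of M is not known
      here.\<close>
    define \<epsilon> where "\<epsilon> = \<Phi> x0 / (2 * exp (\<bar>M\<bar> * r))"
    have "\<epsilon> > 0" using P0 by (simp add: \<epsilon>_def)
    then obtain d where d: "d > 0" "\<And>x. norm x < d \<Longrightarrow> infdist x K \<le> \<epsilon> * norm x ^ Suc k"
      using small[of \<epsilon>] unfolding eventually_nhds_0_norm by blast
    have low: "\<Phi> x < \<Phi> x0" if "norm x < d" "norm x < r" "x \<noteq> 0" for x
    proof -
      have "infdist x K / norm x ^ Suc k \<le> \<epsilon>" using d(2)[OF that(1)] that(3) by (simp add: pos_divide_le_eq del: power_Suc)
      moreover have "exp (- M * norm x) \<le> exp (\<bar>M\<bar> * r)"
        using mult_mono[of "- M" "\<bar>M\<bar>" "norm x" r] that by simp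
      ultimately have "\<Phi> x \<le> \<epsilon> * exp (\<bar>M\<bar> * r)"
        unfolding \<Phi>_def using \<open>\<epsilon> > 0\<close> by (intro mult_mono) auto
      also have "\<dots> < \<Phi> x0" using P0 by (simp add: \<epsilon>_def)
      finally show ?thesis .
    qed
    \<comment> \<open>The minimum keeps \<open>x0\<close> in A even if d exceeds
      \<open>norm x0\<close>. The step from a maximum goes strictly inward, so the outer circle is
      harmless; past the inner one, \<open>low\<close> applies.\<close>
    define A where "A = cball 0 (norm x0) - ball (0::complex) (min d (norm x0))"
    have "compact A" unfolding A_def by (intro compact_diff) auto
    moreover have "x0 \<in> A" by (auto simp: A_def)
    moreover have "0 \<notin> A" using d(1) \<open>x0 \<noteq> 0\<close> by (auto simp: A_def)
    then have "continuous_on A \<Phi>"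
      unfolding \<Phi>_def by (intro continuous_intros) auto
    ultimately obtain x where x: "x \<in> A" "\<And>y. y \<in> A \<Longrightarrow> \<Phi> y \<le> \<Phi> x"
      using continuous_attains_sup[of A \<Phi>] by blast
    have Px: "\<Phi> x \<ge> \<Phi> x0" using x \<open>x0 \<in> A\<close> by blast
    have xr: "norm x \<le> norm x0" "norm x < r" using x(1) x0 by (auto simp: A_def)
    have "infdist x K > 0" using Px P0 infdist_nonneg[of x K] by (cases "infdist x K = 0") (auto simp: \<Phi>_def)
    then obtain x' where x': "0 < norm x'" "norm x' < norm x" "\<Phi> x < \<Phi> x'" using r(2) xr by blast
    have "x' \<notin> A" using x(2)[of x'] x'(3) by auto
    then have "norm x' < d" using x' xr by (auto simp: A_def)
    then show False using low[of x'] x' Px xr by auto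
  qed
  then have "ball 0 r \<subseteq> K" by auto
  then show ?thesis using r(1) by (meson centre_in_ball interiorI open_ball)
qed

subsection \<open>Linearization\<close>

text \<open>The interior of K is mapped into itself by g, so boundedness of K bounds all iterates
  there. Every average has derivative 1 at 0, hence so has the limit h, which is therefore locally
  invertible; its inverse p is the linearizing map.\<close>

lemma linearizable_of_interior:
  fixes g :: "complex \<Rightarrow> complex"
  assumes V: "open V" "K \<subseteq> V" "g holomorphic_on V" "inj_on g V" and K: "compact K" "g ` K \<subseteq> K"
    and int: "0 \<in> interior K" and g0: "g 0 = 0"
    and d: "deriv g 0 = exp (2 * of_real pi * \<i> * of_real \<alpha>)"
    and germ: "\<forall>\<^sub>F z in nhds 0. f z = g z"
  shows "linearizable \<alpha> f"
proof -
  define c where "c = exp (2 * of_real pi * \<i> * of_real \<alpha>)"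
  have nc: "norm c = 1" by (simp add: c_def norm_exp_eq_Re)
  then have c0: "c \<noteq> 0" by auto
  define S where "S = interior K"
  have S: "open S" "0 \<in> S" "S \<subseteq> K" using int interior_subset by (auto simp: S_def)
  have gS: "g holomorphic_on S" "inj_on g S"
    using V S by (auto intro: holomorphic_on_subset inj_on_subset)
  have "open (g ` S)" by (rule open_mapping_thm3[OF gS(1) S(1) gS(2)])
  then have gSS: "g ` S \<subseteq> S" using K(2) S(3) unfolding S_def by (intro interior_maximal) auto
  have it: "(g ^^ n) ` S \<subseteq> S \<and> (g ^^ n) holomorphic_on S" for n
  proof (induction n)
    case (Suc n)
    then have "(g \<circ> (g ^^ n)) holomorphic_on S"
      by (intro holomorphic_on_compose_gen[of _ S g S] gS) auto
    then show ?case
      using Suc gSS unfolding funpow.simps(2) image_comp[symmetric] by blast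
  qed (simp add: holomorphic_on_id[unfolded id_def])
  have iter0: "(g ^^ n) 0 = 0" for n by (induction n) (simp_all add: g0)
  have dg: "((g ^^ n) has_field_derivative c ^ n) (at 0)" for n
  proof (induction n)
    case (Suc n)
    have g1: "(g has_field_derivative c) (at 0)"
      using holomorphic_derivI[OF gS(1) S(1,2)] d by (simp add: c_def)
    then have "((\<lambda>z. g ((g ^^ n) z)) has_field_derivative c * c ^ n) (at 0)"
      using DERIV_chain2[of g c "g ^^ n" 0, OF _ Suc] iter0 by simp
    then show ?case by (simp add: o_def)
  qed (simp add: id_def)
  \<comment> \<open>Any limit h of the averages of the rotated-back iterates satisfies h(g z) = c h(z).\<close>
  define H where "H N z = (\<Sum>n<Suc N. (g ^^ n) z / c ^ n) / of_nat (Suc N)" for N z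
  have Hhol: "H N holomorphic_on S" for N
    unfolding H_def using it c0 by (intro holomorphic_intros) auto
  obtain R where R: "\<And>z. z \<in> K \<Longrightarrow> norm z \<le> R"
    using compact_imp_bounded[OF K(1)] by (auto simp: bounded_iff)
  have iR: "norm ((g ^^ n) z) \<le> R" if "z \<in> S" for n z using it R that S(3) by blast
  have HR: "norm (H N z) \<le> R" if "z \<in> S" for N z
  proof -
    have "norm (\<Sum>n<Suc N. (g ^^ n) z / c ^ n) \<le> (\<Sum>n<Suc N. R)"
      using iR[OF that] nc by (intro sum_norm_le) (simp add: norm_divide norm_power)
    then have "norm (\<Sum>n<Suc N. (g ^^ n) z / c ^ n) \<le> R * real (Suc N)" by (simp add: mult.commute)
    then show ?thesis unfolding H_def norm_divide norm_of_nat by (subst pos_divide_le_eq) auto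
  qed
  obtain h r where h: "h holomorphic_on S" and r: "strict_mono (r :: nat \<Rightarrow> nat)"
    and lim: "\<And>x. x \<in> S \<Longrightarrow> ((\<lambda>n. H (r n) x) \<longlongrightarrow> h x) sequentially"
    and ulim: "\<And>L. \<lbrakk>compact L; L \<subseteq> S\<rbrakk> \<Longrightarrow> uniform_limit L (H \<circ> r) h sequentially"
  proof (rule Montel[OF S(1), of "range H" H])
    show "\<exists>B. \<forall>h\<in>range H. \<forall>z\<in>L. norm (h z) \<le> B" if "L \<subseteq> S" for L
      using HR that by (intro exI[of _ R]) blast
  qed (use Hhol in auto)
  have H0: "(H N has_field_derivative 1) (at 0)" for N
  proof -
    have "(H N has_field_derivative (\<Sum>n<Suc N. c ^ n / c ^ n) / of_nat (Suc N)) (at 0)"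
      unfolding H_def by (intro DERIV_cdivide DERIV_sum dg)
    moreover have "(\<Sum>n<Suc N. c ^ n / c ^ n) = of_nat (Suc N)" using c0 by simp
    ultimately show ?thesis by (metis divide_self of_nat_0_eq_iff nat.distinct(1))
  qed
  obtain h' where h': "\<And>x. x \<in> S \<Longrightarrow> (h has_field_derivative h' x) (at x)"
    "\<And>x. x \<in> S \<Longrightarrow> ((\<lambda>n. deriv (H (r n)) x) \<longlongrightarrow> h' x) sequentially"
  proof -
    have "\<exists>h'. \<forall>x\<in>S. (h has_field_derivative h' x) (at x) \<and> ((\<lambda>n. deriv (H (r n)) x) \<longlongrightarrow> h' x) sequentially"
    proof (rule has_complex_derivative_uniform_sequence[OF S(1), where f = "H \<circ> r"])
      show "((H \<circ> r) n has_field_derivative deriv (H (r n)) x) (at x)" if "x \<in> S" for n x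
        using holomorphic_derivI[OF Hhol S(1) that] by simp
      show "\<exists>d>0. cball x d \<subseteq> S \<and> uniform_limit (cball x d) (H \<circ> r) h sequentially" if "x \<in> S" for x
        using S(1) that ulim by (meson open_contains_cball compact_cball)
    qed
    then show ?thesis using that by blast
  qed
  have "h' 0 = 1"
    using LIMSEQ_unique[OF h'(2)[OF S(2)]] DERIV_imp_deriv[OF H0] by simp
  then have dh: "deriv h 0 = 1" using h'(1)[OF S(2)] DERIV_imp_deriv by fastforce
  have "H N 0 = 0" for N by (simp add: H_def iter0 del: sum.lessThan_Suc)
  then have h0: "h 0 = 0" using LIMSEQ_unique[OF lim[OF S(2)]] by simp
  have fe: "h (g z) = c * h z" if z: "z \<in> S" for z
  proof -
    \<comment> \<open>Composing with g shifts the index of summation, so up to the factor c only the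
      two end terms differ; these are bounded and are divided by N + 1.\<close>
    have eq: "H N (g z) = c * H N z + c * ((g ^^ Suc N) z / c ^ Suc N - z) / of_nat (Suc N)" for N
    proof -
      define a where "a n = (g ^^ n) z / c ^ n" for n
      have "(g ^^ n) (g z) / c ^ n = c * a (Suc n)" for n
        using c0 by (simp add: a_def funpow_swap1)
      then have "(\<Sum>n<Suc N. (g ^^ n) (g z) / c ^ n) = c * (\<Sum>n<Suc N. a (Suc n))"
        by (simp only: sum_distrib_left)
      also have "(\<Sum>n<Suc N. a (Suc n)) = (\<Sum>n<Suc N. a n) + (a (Suc N) - a 0)"
        using sum_lessThan_telescope[of a "Suc N"] by (simp only: sum_subtractf) (simp add: algebra_simps)
      finally have "H N (g z) = c * ((\<Sum>n<Suc N. a n) + (a (Suc N) - a 0)) / of_nat (Suc N)"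
        by (simp only: H_def)
      also have "\<dots> = c * H N z + c * (a (Suc N) - a 0) / of_nat (Suc N)"
        by (simp only: H_def a_def[symmetric] distrib_left add_divide_distrib times_divide_eq_right)
      finally show ?thesis by (simp only: a_def) simp
    qed
    have "((\<lambda>N. c * ((g ^^ Suc N) z / c ^ Suc N - z) / of_nat (Suc N)) \<longlongrightarrow> 0) sequentially"
    proof (rule Lim_null_comparison)
      have "norm (c * ((g ^^ Suc N) z / c ^ Suc N - z) / of_nat (Suc N)) \<le> 2 * R / real (Suc N)" for N
      proof -
        have "norm ((g ^^ Suc N) z / c ^ Suc N - z) \<le> norm ((g ^^ Suc N) z / c ^ Suc N) + norm z"
          by (rule norm_triangle_ineq4)
        also have "\<dots> \<le> R + R"
          using iR[OF z, of "Suc N"] R[of z] z S(3) nc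
          by (intro add_mono) (auto simp: norm_divide norm_power norm_mult)
        finally show ?thesis
          unfolding norm_divide norm_mult norm_of_nat nc by (intro divide_right_mono) auto
      qed
      then show "\<forall>\<^sub>F N in sequentially. norm (c * ((g ^^ Suc N) z / c ^ Suc N - z) / of_nat (Suc N))
          \<le> 2 * R / real (Suc N)" by simp
      show "((\<lambda>N. 2 * R / real (Suc N)) \<longlongrightarrow> 0) sequentially"
        using LIMSEQ_Suc[OF lim_const_over_n[of "2 * R"]] by simp
    qed
    from LIMSEQ_subseq_LIMSEQ[OF this r]
    have "((\<lambda>n. c * H (r n) z + c * ((g ^^ Suc (r n)) z / c ^ Suc (r n) - z) / of_nat (Suc (r n)))
        \<longlongrightarrow> c * h z + 0) sequentially"
      by (intro tendsto_add tendsto_mult tendsto_const lim z) (simp add: o_def)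
    then have "((\<lambda>n. H (r n) (g z)) \<longlongrightarrow> c * h z) sequentially" by (simp only: eq add_0_right)
    moreover have "g z \<in> S" using gSS z by blast
    ultimately show ?thesis using LIMSEQ_unique lim by blast
  qed
  have ha: "h analytic_on {0}" using h S analytic_at by blast
  have ga: "g analytic_on {0}" using gS(1) S analytic_at by blast
  obtain p where p: "p analytic_on {0}" "p 0 = 0" "deriv p 0 = 1"
    "\<forall>\<^sub>F w in nhds 0. h (p w) = w" "\<forall>\<^sub>F z in nhds 0. p (h z) = z"
    using analytic_local_inverse[OF ha h0] dh by auto
  have pt: "filterlim p (nhds 0) (nhds 0)" by (rule analytic_at_zero_tendsto[OF p(1,2)])
  have gt: "filterlim g (nhds 0) (nhds 0)" by (rule analytic_at_zero_tendsto[OF ga g0])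
  have "\<forall>\<^sub>F z in nhds 0. z \<in> S" using S by (intro eventually_nhds_in_open)
  moreover have "\<forall>\<^sub>F z in nhds 0. p (h (g z)) = g z"
    by (rule eventually_compose_filterlim[OF p(5) gt])
  ultimately have "\<forall>\<^sub>F z in nhds 0. f z = p (c * h z)"
    using germ by eventually_elim (simp add: fe)
  then have "\<forall>\<^sub>F w in nhds 0. f (p w) = p (c * h (p w))"
    by (rule eventually_compose_filterlim[OF _ pt])
  with p(4) have "\<forall>\<^sub>F w in nhds 0. h (p w) = w \<and> f (p w) = p (rot \<alpha> w)"
    by eventually_elim (simp add: rot_def c_def)
  then obtain e where e: "e > 0" "\<And>w. norm w < e \<Longrightarrow> h (p w) = w"
    "\<And>w. norm w < e \<Longrightarrow> f (p w) = p (rot \<alpha> w)"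
    unfolding eventually_nhds_0_norm by blast
  obtain e' where e': "e' > 0" "p holomorphic_on ball 0 e'" using p(1) analytic_at_ball by blast
  define \<rho> where "\<rho> = min e e'"
  show ?thesis
    unfolding linearizable_def
  proof (intro exI[of _ \<rho>] exI[of _ p] conjI ballI)
    show "\<rho> > 0" using e e' by (simp add: \<rho>_def)
    show "p holomorphic_on ball 0 \<rho>" using e'(2) by (rule holomorphic_on_subset) (auto simp: \<rho>_def)
    show "inj_on p (ball 0 \<rho>)"
      by (rule inj_on_inverseI[of _ h]) (auto simp: \<rho>_def e(2))
    show "f (p w) = p (rot \<alpha> w)" if "w \<in> ball 0 \<rho>" for w using e(3) that by (auto simp: \<rho>_def)
  qed (use p in auto)
qed

section \<open>Inverses, compositions and iterates of germs preserving K\<close>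

lemma germ_into_inverse:
  fixes T :: "complex \<Rightarrow> complex"
  assumes W: "open W" "K \<subseteq> W" "T holomorphic_on W" "inj_on T W" and K: "0 \<in> K" "K \<subseteq> T ` K"
    and T0: "T 0 = 0"
  obtains v where "germ_into K v" "deriv T 0 * deriv v 0 = 1"
    "\<forall>\<^sub>F z in nhds 0. v (T z) = z"
proof -
  have 0: "0 \<in> W" using K W by blast
  have Ta: "T analytic_on {0}" using W 0 analytic_at by blast
  have "deriv T 0 \<noteq> 0" using holomorphic_injective_imp_regular[OF W(3,1,4) 0] .
  then obtain v where v: "v analytic_on {0}" "v 0 = 0" "deriv T 0 * deriv v 0 = 1"
    "\<forall>\<^sub>F z in nhds 0. T (v z) = z" "\<forall>\<^sub>F z in nhds 0. v (T z) = z"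
    using analytic_local_inverse[OF Ta T0] by blast
  have "\<forall>\<^sub>F z in nhds 0. v z \<in> W"
    using eventually_compose_filterlim[OF eventually_nhds_in_open[OF W(1) 0]
        analytic_at_zero_tendsto[OF v(1,2)]] .
  with v(4) have "\<forall>\<^sub>F z in nhds 0. z \<in> K \<longrightarrow> v z \<in> K"
  proof eventually_elim
    case (elim z)
    show ?case
    proof
      assume "z \<in> K"
      then obtain y where y: "y \<in> K" "z = T y" using K by blast
      then have "v z = y" using elim inj_onD[OF W(4), of "v z" y] W(2) by auto
      then show "v z \<in> K" using y by simp
    qed
  qed
  then show ?thesis using v that unfolding germ_into_def by blast
qed

lemma germ_into_compose:
  assumes "germ_into K u" "germ_into K v"
  shows "germ_into K (\<lambda>z. u (v z))"
proof -
  have u: "u analytic_on {0}" "u 0 = 0" "\<forall>\<^sub>F z in nhds 0. z \<in> K \<longrightarrow> u z \<in> K"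
    and v: "v analytic_on {0}" "v 0 = 0" "\<forall>\<^sub>F z in nhds 0. z \<in> K \<longrightarrow> v z \<in> K"
    using assms unfolding germ_into_def by blast+
  have "(u \<circ> v) analytic_on {0}" using u(1) v(1,2) by (intro analytic_on_compose) simp_all
  moreover have "\<forall>\<^sub>F z in nhds 0. v z \<in> K \<longrightarrow> u (v z) \<in> K"
    by (rule eventually_compose_filterlim[OF u(3) analytic_at_zero_tendsto[OF v(1,2)]])
  with v(3) have "\<forall>\<^sub>F z in nhds 0. z \<in> K \<longrightarrow> u (v z) \<in> K" by eventually_elim blast
  ultimately show ?thesis using u(2) v(2) by (simp add: germ_into_def o_def)
qed

lemma germ_into_funpow:
  assumes g: "germ_into K g"
  shows "germ_into K (g ^^ n) \<and> deriv (g ^^ n) 0 = deriv g 0 ^ n"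
proof (induction n)
  case 0
  show ?case by (auto simp: germ_into_def id_def)
next
  case (Suc n)
  then have gn: "germ_into K (g ^^ n)" "deriv (g ^^ n) 0 = deriv g 0 ^ n" by auto
  have "germ_into K (g ^^ Suc n)" using germ_into_compose[OF g gn(1)] by (simp add: o_def)
  moreover have "deriv (g \<circ> g ^^ n) 0 = deriv g ((g ^^ n) 0) * deriv (g ^^ n) 0"
    using g gn(1) unfolding germ_into_def
    by (intro deriv_chain) (auto intro: analytic_on_imp_differentiable_at)
  moreover have "(g ^^ n) 0 = 0" using gn(1) unfolding germ_into_def by blast
  ultimately show ?case using gn(2) unfolding funpow.simps(2) power_Suc by metis
qed

section \<open>Coefficients of tangent germs preserving K\<close>

lemma sum_of_two_unit_complex:
  fixes w :: complex
  assumes "norm w \<le> 2"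
  obtains a b where "norm a = 1" "norm b = 1" "w = a + b"
proof -
  define t where "t = arccos (norm w / 2)"
  have t: "cos t = norm w / 2" unfolding t_def using assms norm_ge_zero[of w] by (intro cos_arccos) linarith+
  \<comment> \<open>The two unit vectors are the sides of the isosceles triangle with base w, at
    angle t to the direction of w; for w = 0 they are opposite.\<close>
  have "cis (Arg w + t) + cis (Arg w - t) = of_real (2 * cos t) * cis (Arg w)"
    by (simp add: complex_eq_iff cos_add cos_diff sin_add sin_diff)
  also have "\<dots> = of_real (norm w) * cis (Arg w)" by (simp add: t)
  also have "\<dots> = w" using rcis_cmod_Arg[of w] by (simp add: rcis_def)
  finally show ?thesis using that[of "cis (Arg w + t)" "cis (Arg w - t)"] by simp
qed

lemma nonidentity_tangent_order:
  fixes T :: "complex \<Rightarrow> complex"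
  assumes T: "T analytic_on {0}" "T 0 = 0" "deriv T 0 = 1" and ne: "\<not> (\<forall>\<^sub>F z in nhds 0. T z = z)"
  obtains k b where "k \<ge> 1" "b \<noteq> 0" "((\<lambda>z. (T z - z) / z ^ Suc k) \<longlongrightarrow> b) (at 0)"
proof -
  obtain r where r: "r > 0" "T holomorphic_on ball 0 r" using T(1) analytic_at_ball by blast
  have "(\<lambda>z. T z - z) holomorphic_on ball 0 r" using r by (intro holomorphic_intros)
  moreover have "\<not> (\<lambda>z. T z - z) constant_on ball 0 r"
  proof
    assume "(\<lambda>z. T z - z) constant_on ball 0 r"
    then obtain y where y: "\<And>z. z \<in> ball 0 r \<Longrightarrow> T z - z = y" unfolding constant_on_def by blast
    moreover have "y = 0" using y[of 0] T r by simp
    ultimately have "\<And>z. norm z < r \<Longrightarrow> T z = z" by simp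
    then show False using ne r(1) unfolding eventually_nhds_0_norm by blast
  qed
  ultimately obtain G \<rho> n where G: "0 < n" "0 < \<rho>" "G holomorphic_on ball 0 \<rho>"
    "\<And>w. w \<in> ball 0 \<rho> \<Longrightarrow> T w - w = (w - 0) ^ n * G w" "\<And>w. w \<in> ball 0 \<rho> \<Longrightarrow> G w \<noteq> 0"
    using holomorphic_factor_zero_nonconstant[of "\<lambda>z. T z - z" "ball 0 r" 0] r T(2)
    by (metis (no_types, lifting) centre_in_ball connected_ball diff_0_right open_ball)
  have "isCont G 0"
    using G(2,3) by (meson analytic_at_ball analytic_at_imp_isCont)
  then have "(G \<longlongrightarrow> G 0) (at 0)" by (simp add: isCont_def)
  moreover have "\<forall>\<^sub>F z in at 0. z \<in> ball 0 \<rho> \<and> z \<noteq> (0::complex)"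
    using G(2) eventually_at_in_open[of "ball 0 \<rho>" "0::complex"] by simp
  then have "\<forall>\<^sub>F z in at 0. G z = (T z - z) / z ^ n"
    by eventually_elim (use G(4) in simp)
  ultimately have lim: "((\<lambda>z. (T z - z) / z ^ n) \<longlongrightarrow> G 0) (at 0)" by (simp add: tendsto_cong)
  have G0: "G 0 \<noteq> 0" using G(2,5) by simp
  \<comment> \<open>The vanishing order of T z - z at 0 is at least 2 because T'(0) = 1.\<close>
  have "n \<noteq> 1"
  proof
    assume "n = 1"
    have "((\<lambda>z. T z / z - 1) \<longlongrightarrow> 1 - 1) (at 0)"
      using analytic_at_zero_ratio[OF T(1,2)] T(3) by (intro tendsto_intros) simp
    moreover have "\<forall>\<^sub>F z in at (0::complex). T z / z - 1 = (T z - z) / z ^ n"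
      by (auto simp: eventually_at_filter \<open>n = 1\<close> field_simps)
    ultimately have "((\<lambda>z. (T z - z) / z ^ n) \<longlongrightarrow> 0) (at 0)" by (simp add: tendsto_cong)
    then show False using lim G0 tendsto_unique[OF at_neq_bot] by blast
  qed
  then obtain k where "n = Suc k" "k \<ge> 1" using G(1) by (cases n) auto
  then show ?thesis using that lim G0 by blast
qed

text \<open>Formulated for germs preserving K near 0, so that it covers T itself and, under backward
  invariance, its local inverse.\<close>

lemma invariant_germ_is_identity:
  fixes T g :: "complex \<Rightarrow> complex"
  assumes irr: "\<alpha> \<notin> \<rat>" and K: "compact K" "connected K" "0 \<in> K" "K \<noteq> {0}" "0 \<notin> interior K"
    and V: "open V" "K \<subseteq> V" "g holomorphic_on V" "inj_on g V" and gK: "g ` K = K" and g0: "g 0 = 0"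
    and d: "deriv g 0 = exp (2 * of_real pi * \<i> * of_real \<alpha>)"
    and T: "germ_into K T" "deriv T 0 = 1"
  shows "\<forall>\<^sub>F z in nhds 0. T z = z"
proof (rule ccontr)
  define c where "c = exp (2 * of_real pi * \<i> * of_real \<alpha>)"
  have Ta: "T analytic_on {0}" "T 0 = 0" using T(1) unfolding germ_into_def by blast+
  assume "\<not> ?thesis"
  then obtain k b where k: "k \<ge> 1" and b: "b \<noteq> 0" and lim: "((\<lambda>z. (T z - z) / z ^ Suc k) \<longlongrightarrow> b) (at 0)"
    using nonidentity_tangent_order[OF Ta T(2)] by blast
  have "g analytic_on {0}" using V K(3) analytic_at by blast
  moreover have "g z \<in> K" if "z \<in> K" for z using gK that by blast
  ultimately have gg: "germ_into K g" using g0 by (simp add: germ_into_def)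
  then have ga: "g analytic_on {0}" unfolding germ_into_def by blast
  obtain v where v: "germ_into K v" "deriv g 0 * deriv v 0 = 1" "\<forall>\<^sub>F z in nhds 0. v (g z) = z"
    using germ_into_inverse[OF V K(3) _ g0] gK by blast
  have va: "v analytic_on {0}" "v 0 = 0" using v(1) unfolding germ_into_def by blast+
  have conj: "\<exists>w. tangent_germ K k (\<beta> * c ^ k) w" if "tangent_germ K k \<beta> u" for \<beta> u
  proof
    have u: "germ_into K u" "u analytic_on {0}" "u 0 = 0" "((\<lambda>z. (u z - z) / z ^ Suc k) \<longlongrightarrow> \<beta>) (at 0)"
      using that unfolding tangent_germ_def germ_into_def by blast+
    show "tangent_germ K k (\<beta> * c ^ k) (\<lambda>z. v (u (g z)))"
      using germ_into_compose[OF v(1) germ_into_compose[OF u(1) gg]]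
        tangent_conjugate[OF u(2,3) ga g0 va v(3,2) u(4)] d
      unfolding tangent_germ_def c_def by simp
  qed
  have conj_pow: "\<exists>w. tangent_germ K k (b * (c ^ k) ^ n) w" for n
  proof (induction n)
    case 0
    show ?case using T(1) lim by (auto simp: tangent_germ_def)
  next
    case (Suc n)
    then obtain w where "tangent_germ K k (b * (c ^ k) ^ n) w" by blast
    from conj[OF this] show ?case by (simp only: power_Suc2 mult.assoc)
  qed
  have comp: "\<exists>w. tangent_germ K k (\<beta> + \<gamma>) w" if "tangent_germ K k \<beta> u" "tangent_germ K k \<gamma> u'" for \<beta> \<gamma> u u'
  proof
    have u: "germ_into K u" "u analytic_on {0}" "u 0 = 0" "((\<lambda>z. (u z - z) / z ^ Suc k) \<longlongrightarrow> \<beta>) (at 0)"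
      and u': "germ_into K u'" "u' analytic_on {0}" "u' 0 = 0" "((\<lambda>z. (u' z - z) / z ^ Suc k) \<longlongrightarrow> \<gamma>) (at 0)"
      using that unfolding tangent_germ_def germ_into_def by blast+
    show "tangent_germ K k (\<beta> + \<gamma>) (\<lambda>z. u (u' z))"
      using germ_into_compose[OF u(1) u'(1)] tangent_compose[OF u(2,3) u'(2,3) k u(4) u'(4)]
      unfolding tangent_germ_def by blast
  qed
  \<comment> \<open>The coefficients of the conjugates rotate by the angle of \<open>c ^ k\<close>,
    so it is k \<alpha> whose irrationality makes them dense in the circle of radius
    \<open>norm b\<close>.\<close>
  have "real k * \<alpha> \<notin> \<rat>"
  proof
    assume "real k * \<alpha> \<in> \<rat>"
    then have "real k * \<alpha> / real k \<in> \<rat>" by (intro Rats_divide Rats_of_nat)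
    then show False using irr k by simp
  qed
  have ck: "c ^ k = exp (2 * of_real pi * \<i> * of_real (real k * \<alpha>))"
    by (simp add: c_def exp_of_nat_mult[symmetric] algebra_simps)
  have "0 \<in> interior K"
  proof (rule invariant_compact_contains_nhd[OF K(1-4) k, of "2 * norm b"])
    show "2 * norm b > 0" using b by simp
    show "\<exists>h. germ_into K h \<and> dist (deriv h 0) e < \<epsilon>" if "norm e = 1" "\<epsilon> > 0" for e \<epsilon>
    proof -
      obtain n where "norm (c ^ n - e) < \<epsilon>"
        using irrational_rotation_dense[OF irr \<open>norm e = 1\<close> \<open>\<epsilon> > 0\<close>] unfolding c_def by blast
      then show ?thesis using germ_into_funpow[OF gg, of n] d
        by (intro exI[of _ "g ^^ n"]) (simp add: dist_norm c_def)
    qed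
    show "\<exists>\<gamma> u. dist \<gamma> \<beta> < \<epsilon> \<and> tangent_germ K k \<gamma> u" if "norm \<beta> \<le> 2 * norm b" "\<epsilon> > 0" for \<beta> \<epsilon>
    proof -
      have "norm (\<beta> / b) \<le> 2" using that(1) b by (simp add: norm_divide field_simps)
      then obtain e1 e2 where e: "norm e1 = 1" "norm e2 = 1" "\<beta> / b = e1 + e2"
        using sum_of_two_unit_complex by blast
      \<comment> \<open>Each of the two unit vectors is approximated within \<delta> and then
        multiplied by b, giving a total error below \<epsilon>.\<close>
      define \<delta> where "\<delta> = \<epsilon> / (2 * norm b)"
      have "\<delta> > 0" using that(2) b by (simp add: \<delta>_def)
      note dense = irrational_rotation_dense[OF \<open>real k * \<alpha> \<notin> \<rat>\<close> _ \<open>\<delta> > 0\<close>, folded ck]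
      obtain n1 n2 where n: "norm ((c ^ k) ^ n1 - e1) < \<delta>" "norm ((c ^ k) ^ n2 - e2) < \<delta>"
        using dense[OF e(1)] dense[OF e(2)] by blast
      obtain w where w: "tangent_germ K k (b * (c ^ k) ^ n1 + b * (c ^ k) ^ n2) w"
        using conj_pow[of n1] conj_pow[of n2] comp by blast
      have "\<beta> = b * e1 + b * e2" using e(3) b by (simp add: field_simps)
      then have "b * (c ^ k) ^ n1 + b * (c ^ k) ^ n2 - \<beta> = b * (((c ^ k) ^ n1 - e1) + ((c ^ k) ^ n2 - e2))"
        by (simp only: algebra_simps)
      then have "norm (b * (c ^ k) ^ n1 + b * (c ^ k) ^ n2 - \<beta>)
          = norm b * norm (((c ^ k) ^ n1 - e1) + ((c ^ k) ^ n2 - e2))" by (simp only: norm_mult)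
      also have "norm (((c ^ k) ^ n1 - e1) + ((c ^ k) ^ n2 - e2)) < \<delta> + \<delta>"
        using n by (intro norm_add_less)
      then have "norm b * norm (((c ^ k) ^ n1 - e1) + ((c ^ k) ^ n2 - e2)) < norm b * (\<delta> + \<delta>)"
        using b by (intro mult_strict_left_mono) auto
      also have "\<dots> = \<epsilon>" using b by (simp add: \<delta>_def)
      finally show ?thesis using w unfolding dist_norm by blast
    qed
  qed
  with K(5) show False by blast
qed

theorem theorem3p1:
  fixes \<alpha> :: real and f T :: "complex \<Rightarrow> complex" and K W U :: "complex set"
  assumes irr: "\<alpha> \<notin> \<rat>"
    and f_germ: "open U" "0 \<in> U" "f holomorphic_on U" "inj_on f U"
    and f0: "f 0 = 0" and f'0: "deriv f 0 = exp (2 * of_real pi * \<i> * of_real \<alpha>)"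
    and nonlin: "\<not> linearizable \<alpha> f"
    and hh: "hedgehog \<alpha> f K"
    and T_univ: "open W" "K \<subseteq> W" "T holomorphic_on W" "inj_on T W"
    and T0: "T 0 = 0" and T'0: "deriv T 0 = 1"
    and inv: "T ` K \<subseteq> K \<or> K \<subseteq> T ` K"
  shows "\<exists>e>0. \<forall>z\<in>ball 0 e. T z = z"
proof -
  from hh obtain V g where K: "compact K" "connected K" "0 \<in> K" "K \<noteq> {0}"
    and V: "open V" "K \<subseteq> V" "g holomorphic_on V" "inj_on g V"
    and germ: "same_germ0 g f V" and gK: "g ` K = K"
    unfolding hedgehog_def siegel_compact_def by blast
  obtain e where "e > 0" "\<And>z. z \<in> ball 0 e \<Longrightarrow> g z = f z"
    using germ unfolding same_germ0_def by blast
  then have gf: "\<forall>\<^sub>F z in nhds 0. g z = f z" unfolding eventually_nhds_0_norm by auto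
  then have g0: "g 0 = 0" using eventually_nhds_x_imp_x[of "\<lambda>z. g z = f z" 0] f0 by simp
  have dg: "deriv g 0 = exp (2 * of_real pi * \<i> * of_real \<alpha>)"
    using deriv_cong_ev[OF gf refl] f'0 by simp
  \<comment> \<open>Nonlinearizability enters here: an interior point at 0 would give a
    linearization of g, and g and f are the same germ.\<close>
  have "0 \<notin> interior K"
    using linearizable_of_interior[OF V K(1) _ _ g0 dg, of f] gK nonlin gf
    by (auto simp: eq_commute elim: eventually_mono)
  note identity = invariant_germ_is_identity[OF irr K this V gK g0 dg]
  have "\<forall>\<^sub>F z in nhds 0. T z = z"
    using inv
  proof
    assume "T ` K \<subseteq> K"
    then have "T z \<in> K" if "z \<in> K" for z using that by blast
    moreover have "T analytic_on {0}" using T_univ K(3) analytic_at by blast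
    ultimately have "germ_into K T" using T0 by (simp add: germ_into_def)
    then show ?thesis using identity T'0 by blast
  next
    assume "K \<subseteq> T ` K"
    then obtain v where v: "germ_into K v" "deriv T 0 * deriv v 0 = 1" "\<forall>\<^sub>F z in nhds 0. v (T z) = z"
      using germ_into_inverse[OF T_univ K(3) _ T0] by blast
    \<comment> \<open>The derivative of v at 0 is the reciprocal of T'(0) = 1, so v is tangent to
      the identity as well.\<close>
    then have vid: "\<forall>\<^sub>F z in nhds 0. v z = z" using identity T'0 by simp
    have "T analytic_on {0}" using T_univ K(3) analytic_at by blast
    from eventually_compose_filterlim[OF vid analytic_at_zero_tendsto[OF this T0]] v(3)
    show ?thesis by eventually_elim simp
  qed
  then show ?thesis unfolding eventually_nhds_0_norm by auto
qed

end
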